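(* The following are equivalent: (i) the Kadison-Singer conjecture is true, i.e. for every $\omega\in\beta\mathbb N$ the state $s_\omega$ on $\mathcal D$ extends uniquely to a state on $B(\ell^2(\mathbb N))$; (ii) for each $T\in\mathcal T_0(\mathbb N)$ and each $\epsilon>0$, there exist an $r$ and an $r$-paving $\{A_1,\dots,A_r\}$ of $\mathbb N$ with $-\epsilon P_{A_i}\le P_{A_i}(T+T^* )P_{A_i}\le\epsilon P_{A_i}$ for $i=1,\dots,r$; (iii) for each $T\in\mathcal T_0(\mathbb N)$ and each $\epsilon>0$, there exist an $r$ and an $r$-paving $\{A_1,\dots,A_r\}$ of $\mathbb N$ such that $\|P_{A_i}TP_{A_i}\|<\epsilon$ for $i=1,\dots,r$.
   Context: Operators $X\in B(\ell^2(\mathbb N))$ (complex Hilbert space) are identified with their infinite matrices $X=(x_{i,j})$ with respect to the canonical orthonormal basis. $\mathcal D\subseteq B(\ell^2(\mathbb N))$ is the algebra (MASA) of diagonal operators. $\mathcal D$ is identified with the continuous functions on the Stone-Čech compactification $\beta\mathbb N$ (a bounded diagonal sequence is identified with its continuous extension to $\beta\mathbb N$), and for $\omega\in\beta\mathbb N$, $s_\omega:\mathcal D\to\mathbb C$ is the *-homomorphism given by evaluation at $\omega$; these are exactly the pure states of $\mathcal D$. For $A\subseteq\mathbb N$, $P_A$ is the diagonal projection whose $(i,i)$ entry is $1$ if and only if $i\in A$. An $r$-paving of $\mathbb N$ is a finite collection of disjoint subsets $\{A_1,\dots,A_r\}$ with $\mathbb N=A_1\cup\dots\cup A_r$. $\mathcal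 T_0(\mathbb N)$ is the set of strictly upper triangular operators, i.e. $T=(t_{i,j})\in B(\ell^2(\mathbb N))$ with $t_{i,j}=0$ for all $i\ge j$. *)

theory Defs
  imports "HOL-Analysis.Analysis"
begin

section \<open>The complex Hilbert space of square-summable sequences\<close>

typedef ell2 = "{x :: nat \<Rightarrow> complex. summable (\<lambda>n. (cmod (x n))\<^sup>2)}"
  morphisms coord Abs_ell2
  by (rule exI[of _ "\<lambda>_. 0"]) simp

setup_lifting type_definition_ell2

lemma summable_coord: "summable (\<lambda>n. (cmod (coord x n))\<^sup>2)"
  using coord[of x] by simp

lemma ell2_eqI: "(\<And>n. coord x n = coord y n) \<Longrightarrow> x = y"
  by (rule iffD1[OF coord_inject]) (rule HOL.ext)

lemma square_summable_add:
  fixes x y :: "nat \<Rightarrow> complex"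
  assumes "summable (\<lambda>n. (cmod (x n))\<^sup>2)" and "summable (\<lambda>n. (cmod (y n))\<^sup>2)"
  shows "summable (\<lambda>n. (cmod (x n + y n))\<^sup>2)"
proof (rule summable_comparison_test')
  show "summable (\<lambda>n. 2 * (cmod (x n))\<^sup>2 + 2 * (cmod (y n))\<^sup>2)"
    using assms by (intro summable_add summable_mult)
  fix n
  have "(cmod (x n + y n))\<^sup>2 \<le> (cmod (x n) + cmod (y n))\<^sup>2"
    by (intro power_mono norm_triangle_ineq norm_ge_zero)
  also have "\<dots> \<le> 2 * (cmod (x n))\<^sup>2 + 2 * (cmod (y n))\<^sup>2"
    using sum_squares_bound[of "cmod (x n)" "cmod (y n)"]
    unfolding power2_sum by linarith
  finally show "norm ((cmod (x n + y n))\<^sup>2) \<le> 2 * (cmod (x n))\<^sup>2 + 2 * (cmod (y n))\<^sup>2"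
    by simp
qed

lemma square_summable_scale:
  fixes x :: "nat \<Rightarrow> complex"
  assumes "summable (\<lambda>n. (cmod (x n))\<^sup>2)"
  shows "summable (\<lambda>n. (cmod (c * x n))\<^sup>2)"
  using summable_mult[OF assms, of "(cmod c)\<^sup>2"] by (simp add: norm_mult power_mult_distrib)

lemma summable_norm_coord_mult: "summable (\<lambda>n. cmod (coord x n) * cmod (coord y n))"
proof (rule summable_comparison_test')
  show "summable (\<lambda>n. (cmod (coord x n))\<^sup>2 + (cmod (coord y n))\<^sup>2)"
    by (intro summable_add summable_coord)
  fix n
  show "norm (cmod (coord x n) * cmod (coord y n)) \<le> (cmod (coord x n))\<^sup>2 + (cmod (coord y n))\<^sup>2"
    using sum_squares_bound[of "cmod (coord x n)" "cmod (coord y n)"]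
      mult_nonneg_nonneg[OF norm_ge_zero[of "coord x n"] norm_ge_zero[of "coord y n"]]
    unfolding real_norm_def by linarith
qed

lemma summable_inner_coord: "summable (\<lambda>n. coord x n \<bullet> coord y n)"
  by (rule summable_comparison_test'[OF summable_norm_coord_mult[of x y]])
    (simp add: Cauchy_Schwarz_ineq2)

lemma summable_cinner_coord: "summable (\<lambda>n. coord x n * cnj (coord y n))"
  by (rule summable_comparison_test'[OF summable_norm_coord_mult[of x y]])
    (simp add: norm_mult)

instantiation ell2 :: real_vector
begin

lift_definition zero_ell2 :: ell2 is "\<lambda>_. 0" by simp
lift_definition plus_ell2 :: "ell2 \<Rightarrow> ell2 \<Rightarrow> ell2" is "\<lambda>x y n. x n + y n"
  by (rule square_summable_add)
lift_definition uminus_ell2 :: "ell2 \<Rightarrow> ell2" is "\<lambda>x n. - x n" by simp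
lift_definition minus_ell2 :: "ell2 \<Rightarrow> ell2 \<Rightarrow> ell2" is "\<lambda>x y n. x n - y n"
  subgoal for x y using square_summable_add[of x "\<lambda>n. - y n"] by simp
  done
lift_definition scaleR_ell2 :: "real \<Rightarrow> ell2 \<Rightarrow> ell2" is "\<lambda>r x n. r *\<^sub>R x n"
  by (simp add: scaleR_conv_of_real square_summable_scale)

instance
proof
  fix x y z :: ell2 and a b :: real
  show "x + y + z = x + (y + z)" by transfer (simp add: add.assoc)
  show "x + y = y + x" by transfer (simp add: add.commute)
  show "0 + x = x" by transfer simp
  show "- x + x = 0" by transfer simp
  show "x - y = x + - y" by transfer simp
  show "a *\<^sub>R (x + y) = a *\<^sub>R x + a *\<^sub>R y" by transfer (simp add: scaleR_add_right)
  show "(a + b) *\<^sub>R x = a *\<^sub>R x + b *\<^sub>R x" by transfer (simp add: scaleR_add_left)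
  show "a *\<^sub>R b *\<^sub>R x = (a * b) *\<^sub>R x" by transfer simp
  show "1 *\<^sub>R x = x" by transfer simp
qed

end

instantiation ell2 :: real_inner
begin

definition inner_ell2 :: "ell2 \<Rightarrow> ell2 \<Rightarrow> real"
  where "inner_ell2 x y = (\<Sum>n. coord x n \<bullet> coord y n)"
definition norm_ell2 :: "ell2 \<Rightarrow> real"
  where "norm_ell2 x = sqrt (inner x x)"
definition sgn_ell2 :: "ell2 \<Rightarrow> ell2"
  where "sgn_ell2 x = x /\<^sub>R norm x"
definition dist_ell2 :: "ell2 \<Rightarrow> ell2 \<Rightarrow> real"
  where "dist_ell2 x y = norm (x - y)"
definition uniformity_ell2 :: "(ell2 \<times> ell2) filter"
  where "uniformity_ell2 = (INF e\<in>{0 <..}. principal {(x, y). dist x y < e})"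
definition open_ell2 :: "ell2 set \<Rightarrow> bool"
  where "open_ell2 U \<longleftrightarrow> (\<forall>x\<in>U. \<forall>\<^sub>F (x', y) in uniformity. x' = x \<longrightarrow> y \<in> U)"

instance
proof
  fix x y z :: ell2 and r :: real
  show "sgn x = x /\<^sub>R norm x" by (rule sgn_ell2_def)
  show "dist x y = norm (x - y)" by (rule dist_ell2_def)
  show "(uniformity :: (ell2 \<times> ell2) filter) = (INF e\<in>{0 <..}. principal {(x, y). dist x y < e})"
    by (rule uniformity_ell2_def)
  show "open U \<longleftrightarrow> (\<forall>x\<in>U. \<forall>\<^sub>F (x', y) in uniformity. x' = x \<longrightarrow> y \<in> U)" for U :: "ell2 set"
    by (rule open_ell2_def)
  show "inner x y = inner y x" by (simp add: inner_ell2_def inner_commute)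
  show "inner (x + y) z = inner x z + inner y z"
    by (simp add: inner_ell2_def plus_ell2.rep_eq inner_add_left suminf_add summable_inner_coord)
  show "inner (r *\<^sub>R x) y = r * inner x y"
    by (simp add: inner_ell2_def scaleR_ell2.rep_eq suminf_mult summable_inner_coord)
  show "0 \<le> inner x x"
    by (simp add: inner_ell2_def suminf_nonneg summable_inner_coord)
  show "inner x x = 0 \<longleftrightarrow> x = 0"
  proof -
    have "inner x x = 0 \<longleftrightarrow> (\<forall>n. coord x n \<bullet> coord x n = 0)"
      unfolding inner_ell2_def by (rule suminf_eq_zero_iff) (auto simp: summable_inner_coord)
    also have "\<dots> \<longleftrightarrow> x = 0"
      by (auto intro!: ell2_eqI simp: zero_ell2.rep_eq)
    finally show ?thesis .
  qed
  show "norm x = sqrt (inner x x)" by (rule norm_ell2_def)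
qed

end

lemma norm_ell2_square: "(norm (x :: ell2))\<^sup>2 = (\<Sum>n. (cmod (coord x n))\<^sup>2)"
  by (simp only: power2_norm_eq_inner inner_ell2_def)

lift_definition scaleC :: "complex \<Rightarrow> ell2 \<Rightarrow> ell2" is "\<lambda>c x n. c * x n"
  by (rule square_summable_scale)

text \<open>Linear in the first argument and conjugate-linear in the second one.\<close>

definition cinner :: "ell2 \<Rightarrow> ell2 \<Rightarrow> complex"
  where "cinner x y = (\<Sum>n. coord x n * cnj (coord y n))"

text \<open>The inner product of the class \<^class>\<open>real_inner\<close> is the real part of the complex one,
  and both induce the same norm.\<close>

lemma Re_cinner: "Re (cinner x y) = inner x y"
  by (simp add: cinner_def inner_ell2_def Re_suminf summable_cinner_coord inner_complex_def)

lemma cinner_self: "cinner x x = of_real ((norm x)\<^sup>2)"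
proof -
  have "cinner x x = (\<Sum>n. of_real (coord x n \<bullet> coord x n))"
    unfolding cinner_def
    by (simp add: complex_mult_cnj inner_complex_def power2_eq_square)
  also have "\<dots> = of_real (inner x x)"
    by (simp add: inner_ell2_def suminf_of_real summable_inner_coord)
  finally show ?thesis by (simp add: power2_norm_eq_inner)
qed

lift_definition unit_vec :: "nat \<Rightarrow> ell2" is "\<lambda>i n. if n = i then 1 else 0"
  subgoal for i by (rule summable_finite[of "{i}"]) auto
  done


section \<open>Bounded operators\<close>

text \<open>The type \<^typ>\<open>ell2 \<Rightarrow>\<^sub>L ell2\<close> consists of the bounded real-linear operators, with the
  operator norm; the algebra of all bounded operators on the complex Hilbert space is its subset of
  complex-linear ones.\<close>

definition bounded_ops :: "(ell2 \<Rightarrow>\<^sub>L ell2) set"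
  where "bounded_ops = {X :: ell2 \<Rightarrow>\<^sub>L ell2. \<forall>c x. X (scaleC c x) = scaleC c (X x)}"

definition entry :: "(ell2 \<Rightarrow>\<^sub>L ell2) \<Rightarrow> nat \<Rightarrow> nat \<Rightarrow> complex"
  where "entry X i j = cinner (X (unit_vec j)) (unit_vec i)"

definition diagonal_ops :: "(ell2 \<Rightarrow>\<^sub>L ell2) set"
  where "diagonal_ops = {X \<in> bounded_ops. \<forall>i j. i \<noteq> j \<longrightarrow> entry X i j = 0}"

definition strictly_upper_ops :: "(ell2 \<Rightarrow>\<^sub>L ell2) set"
  where "strictly_upper_ops = {T \<in> bounded_ops. \<forall>i j. i \<ge> j \<longrightarrow> entry T i j = 0}"

lemma norm_scaleC: "norm (scaleC c x) = cmod c * norm x"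
proof -
  have "(norm (scaleC c x))\<^sup>2 = (\<Sum>n. (cmod (c * coord x n))\<^sup>2)"
    by (simp only: norm_ell2_square scaleC.rep_eq)
  also have "\<dots> = (\<Sum>n. (cmod c)\<^sup>2 * (cmod (coord x n))\<^sup>2)"
    by (simp only: norm_mult power_mult_distrib)
  also have "\<dots> = (cmod c * norm x)\<^sup>2"
    by (simp only: suminf_mult[OF summable_coord] norm_ell2_square power_mult_distrib)
  finally show ?thesis
    by (simp add: power2_eq_iff_nonneg)
qed

lemma bounded_linear_scaleC: "bounded_linear (scaleC c)"
proof
  show "scaleC c (x + y) = scaleC c x + scaleC c y" for x y
    by transfer (simp add: distrib_left)
  show "scaleC c (r *\<^sub>R x) = r *\<^sub>R scaleC c x" for r x
    by transfer simp
  show "\<exists>K. \<forall>x. norm (scaleC c x) \<le> norm x * K"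
    by (rule exI[of _ "cmod c"]) (simp add: norm_scaleC mult.commute)
qed

definition scaleC_op :: "complex \<Rightarrow> (ell2 \<Rightarrow>\<^sub>L ell2) \<Rightarrow> (ell2 \<Rightarrow>\<^sub>L ell2)"
  where "scaleC_op c X = Blinfun (\<lambda>x. scaleC c (X x))"

lemma scaleC_op_apply: "scaleC_op c X x = scaleC c (X x)"
  unfolding scaleC_op_def
  by (subst bounded_linear_Blinfun_apply)
    (auto intro: bounded_linear_compose[OF bounded_linear_scaleC] blinfun.bounded_linear_right)

definition adj :: "(ell2 \<Rightarrow>\<^sub>L ell2) \<Rightarrow> (ell2 \<Rightarrow>\<^sub>L ell2)"
  where "adj X = (THE Y :: ell2 \<Rightarrow>\<^sub>L ell2. \<forall>x y. cinner (X x) y = cinner x (Y y))"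

definition positive_op :: "(ell2 \<Rightarrow>\<^sub>L ell2) \<Rightarrow> bool"
  where "positive_op X \<longleftrightarrow> (\<forall>x. cinner (X x) x \<in> \<real>\<^sub>\<ge>\<^sub>0)"

definition op_le :: "(ell2 \<Rightarrow>\<^sub>L ell2) \<Rightarrow> (ell2 \<Rightarrow>\<^sub>L ell2) \<Rightarrow> bool"  (infix \<open>\<preceq>\<close> 50)
  where "X \<preceq> Y \<longleftrightarrow> positive_op (Y - X)"

lift_definition restrict_coords :: "nat set \<Rightarrow> ell2 \<Rightarrow> ell2" is "\<lambda>A x n. if n \<in> A then x n else 0"
  subgoal for A x by (rule summable_comparison_test'[where g = "\<lambda>n. (cmod (x n))\<^sup>2"]) auto
  done

lemma norm_restrict_coords: "norm (restrict_coords A x) \<le> norm x"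
proof -
  have "inner (restrict_coords A x) (restrict_coords A x) \<le> inner x x"
    unfolding inner_ell2_def
    by (rule suminf_le[OF _ summable_inner_coord summable_inner_coord])
      (simp add: restrict_coords.rep_eq)
  then show ?thesis by (simp add: norm_eq_sqrt_inner[where 'a = ell2])
qed

lemma bounded_linear_restrict_coords: "bounded_linear (restrict_coords A)"
proof
  show "restrict_coords A (x + y) = restrict_coords A x + restrict_coords A y" for x y
    by transfer auto
  show "restrict_coords A (r *\<^sub>R x) = r *\<^sub>R restrict_coords A x" for r x
    by transfer auto
  show "\<exists>K. \<forall>x. norm (restrict_coords A x) \<le> norm x * K"
    by (rule exI[of _ 1]) (simp add: norm_restrict_coords)
qed

definition diag_proj :: "nat set \<Rightarrow> ell2 \<Rightarrow>\<^sub>L ell2"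
  where "diag_proj A = Blinfun (restrict_coords A)"

lemma diag_proj_apply: "diag_proj A x = restrict_coords A x"
  by (simp add: diag_proj_def bounded_linear_Blinfun_apply bounded_linear_restrict_coords)

definition paving :: "nat \<Rightarrow> (nat \<Rightarrow> nat set) \<Rightarrow> bool"
  where "paving r A \<longleftrightarrow> disjoint_family_on A {1..r} \<and> (\<Union>i\<in>{1..r}. A i) = UNIV"


subsection \<open>Existence and uniqueness of adjoints\<close>

lemma coord_sum: "coord (\<Sum>i\<in>I. f i) n = (\<Sum>i\<in>I. coord (f i) n)"
  by (induction I rule: infinite_finite_induct) (auto simp: zero_ell2.rep_eq plus_ell2.rep_eq)

lemma cinner_add_left: "cinner (x + y) z = cinner x z + cinner y z"
  by (simp add: cinner_def plus_ell2.rep_eq distrib_right suminf_add summable_cinner_coord)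

lemma cinner_scaleC_left: "cinner (scaleC c x) y = c * cinner x y"
  by (simp add: cinner_def scaleC.rep_eq mult.assoc suminf_mult summable_cinner_coord)

lemma cinner_commute: "cinner y x = cnj (cinner x y)"
proof -
  have "(\<lambda>n. coord x n * cnj (coord y n)) sums cinner x y"
    by (simp add: cinner_def summable_cinner_coord summable_sums)
  then have "(\<lambda>n. cnj (coord x n * cnj (coord y n))) sums cnj (cinner x y)"
    by (subst sums_cnj)
  then show ?thesis
    by (simp add: cinner_def sums_iff mult.commute)
qed

lemma cinner_add_right: "cinner x (y + z) = cinner x y + cinner x z"
  by (simp add: cinner_commute[of x] cinner_add_left)

lemma cinner_scaleC_right: "cinner x (scaleC c y) = cnj c * cinner x y"
  by (simp add: cinner_commute[of x] cinner_scaleC_left)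

lemma scaleR_eq_scaleC: "r *\<^sub>R x = scaleC (of_real r) x"
  by transfer (simp add: scaleR_conv_of_real)

lemma cinner_cauchy_schwarz: "cmod (cinner x y) \<le> norm x * norm y"
proof (cases "cinner x y = 0")
  case False
  define c where "c = cnj (cinner x y) / of_real (cmod (cinner x y))"
  have "cmod c = 1"
    using False by (simp add: c_def norm_divide)
  have "cnj (cinner x y) * cinner x y = of_real (cmod (cinner x y)) * of_real (cmod (cinner x y))"
    by (metis complex_norm_square mult.commute power2_eq_square of_real_mult)
  then have "c * cinner x y = of_real (cmod (cinner x y))"
    using False by (simp add: c_def)
  then have "cmod (cinner x y) = Re (cinner (scaleC c x) y)"
    by (simp add: cinner_scaleC_left)
  also have "\<dots> \<le> norm (scaleC c x) * norm y"
    by (simp add: Re_cinner norm_cauchy_schwarz)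
  finally show ?thesis using \<open>cmod c = 1\<close> by (simp add: norm_scaleC)
qed simp

lemma bounded_linear_cinner_left: "bounded_linear (\<lambda>x. cinner x y)"
proof
  show "cinner (x + x') y = cinner x y + cinner x' y" for x x'
    by (rule cinner_add_left)
  show "cinner (r *\<^sub>R x) y = r *\<^sub>R cinner x y" for r x
    by (simp add: scaleR_eq_scaleC cinner_scaleC_left scaleR_conv_of_real)
  show "\<exists>K. \<forall>x. cmod (cinner x y) \<le> norm x * K"
    using cinner_cauchy_schwarz by blast
qed

lemma cinner_unit_vec_right: "cinner x (unit_vec n) = coord x n"
proof -
  have "cinner x (unit_vec n) = (\<Sum>k. if k = n then coord x k else 0)"
    unfolding cinner_def by (rule arg_cong[where f = suminf]) (auto simp: unit_vec.rep_eq)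
  also have "\<dots> = coord x n"
    using sums_single[of n "\<lambda>k. coord x k"] by (simp add: sums_iff)
  finally show ?thesis .
qed

lemma unit_vec_expansion: "(\<lambda>n. scaleC (coord x n) (unit_vec n)) sums x"
proof -
  define s where "s N = (\<Sum>n<N. scaleC (coord x n) (unit_vec n))" for N
  have coord_s: "coord (s N) n = (if n < N then coord x n else 0)" for N n
    by (simp add: s_def coord_sum scaleC.rep_eq unit_vec.rep_eq if_distrib sum.delta cong: if_cong)
  have "(norm (s N - x))\<^sup>2 = (\<Sum>n. coord x (n + N) \<bullet> coord x (n + N))" for N
  proof -
    have z: "coord (s N - x) n \<bullet> coord (s N - x) n = (if n < N then 0 else coord x n \<bullet> coord x n)" for n
      by (simp add: minus_ell2.rep_eq coord_s)
    have "(norm (s N - x))\<^sup>2 = (\<Sum>n. coord (s N - x) n \<bullet> coord (s N - x) n)"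
      by (simp add: power2_norm_eq_inner inner_ell2_def)
    also have "\<dots> = (\<Sum>n. coord (s N - x) (n + N) \<bullet> coord (s N - x) (n + N))
        + (\<Sum>n<N. coord (s N - x) n \<bullet> coord (s N - x) n)"
      by (rule suminf_split_initial_segment) (rule summable_inner_coord)
    finally show ?thesis by (simp add: z)
  qed
  moreover have "(\<lambda>N. \<Sum>n. coord x (n + N) \<bullet> coord x (n + N)) \<longlonglongrightarrow> 0"
    by (rule suminf_exist_split2) (rule summable_inner_coord)
  ultimately have "(\<lambda>N. (norm (s N - x))\<^sup>2) \<longlonglongrightarrow> 0"
    by simp
  then have "(\<lambda>N. sqrt ((norm (s N - x))\<^sup>2)) \<longlonglongrightarrow> sqrt 0"
    by (rule tendsto_real_sqrt)
  then show ?thesis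
    unfolding sums_def s_def[symmetric] LIM_zero_iff[symmetric, of s x]
    by (simp add: tendsto_norm_zero_iff LIM_zero_iff)
qed

lemma square_summable_adjoint_coords:
  assumes X: "X \<in> bounded_ops"
  shows "summable (\<lambda>n. (cmod (cinner y (X (unit_vec n))))\<^sup>2)"
    and "(\<Sum>n. (cmod (cinner y (X (unit_vec n))))\<^sup>2) \<le> (norm X * norm y)\<^sup>2"
proof -
  define v where "v n = cinner y (X (unit_vec n))" for n
  have bound: "(\<Sum>n<N. (cmod (v n))\<^sup>2) \<le> (norm X * norm y)\<^sup>2" for N
  proof -
    define S where "S = (\<Sum>n<N. (cmod (v n))\<^sup>2)"
    define x where "x = (\<Sum>n<N. scaleC (v n) (unit_vec n))"
    have "coord x n = (if n < N then v n else 0)" for n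
      by (simp add: x_def coord_sum scaleC.rep_eq unit_vec.rep_eq if_distrib sum.delta cong: if_cong)
    then have "(norm x)\<^sup>2 = (\<Sum>n. if n < N then (cmod (v n))\<^sup>2 else 0)"
      by (auto simp: power2_norm_eq_inner inner_ell2_def if_distrib
          simp flip: power2_norm_eq_inner cong: if_cong)
        (auto simp: power2_norm_eq_inner inner_ell2_def intro!: arg_cong[where f = suminf])
    also have "\<dots> = S"
      unfolding S_def by (subst suminf_finite[of "{..<N}"]) auto
    finally have normx: "(norm x)\<^sup>2 = S" .
    have "cinner (X x) y = (\<Sum>n<N. v n * cinner (X (unit_vec n)) y)"
      using X unfolding x_def
      by (simp add: blinfun.sum_right bounded_ops_def cinner_scaleC_left
          linear_sum[OF bounded_linear.linear[OF bounded_linear_cinner_left]])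
    also have "\<dots> = of_real S"
      unfolding S_def v_def
      by (simp add: cinner_commute[of "X _" y] complex_norm_square del: of_real_power)
    finally have "S \<le> norm (X x) * norm y"
      using cinner_cauchy_schwarz[of "X x" y] by simp
    also have "\<dots> \<le> (norm X * norm x) * norm y"
      by (simp add: mult_right_mono norm_blinfun)
    finally have le: "(norm x)\<^sup>2 \<le> (norm X * norm y) * norm x"
      by (simp add: normx mult_ac)
    have "norm x \<le> norm X * norm y"
    proof (cases "norm x = 0")
      case False
      then show ?thesis
        using le by (simp add: power2_eq_square)
    qed simp
    then show ?thesis
      unfolding S_def[symmetric] normx[symmetric] by (simp add: power_mono)
  qed
  show summ: "summable (\<lambda>n. (cmod (cinner y (X (unit_vec n))))\<^sup>2)"
    unfolding v_def[symmetric]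
    by (rule bounded_imp_summable[where B = "(norm X * norm y)\<^sup>2"])
      (use bound[of "Suc _"] in \<open>auto simp: lessThan_Suc_atMost\<close>)
  show "(\<Sum>n. (cmod (cinner y (X (unit_vec n))))\<^sup>2) \<le> (norm X * norm y)\<^sup>2"
    using suminf_le_const[OF summ] bound unfolding v_def by auto
qed

lemma adjoint_unique:
  fixes Y Z :: "ell2 \<Rightarrow>\<^sub>L ell2"
  assumes "\<forall>x y. cinner (X x) y = cinner x (Y y)" and "\<forall>x y. cinner (X x) y = cinner x (Z y)"
  shows "Y = Z"
proof (intro blinfun_eqI ell2_eqI)
  fix y n
  have "cinner (unit_vec n) (Y y) = cinner (unit_vec n) (Z y)"
    using assms(1)[rule_format, of "unit_vec n" y] assms(2)[rule_format, of "unit_vec n" y] by simp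
  then have "cinner (Y y) (unit_vec n) = cinner (Z y) (unit_vec n)"
    by (subst (1 2) cinner_commute) simp
  then show "coord (Y y) n = coord (Z y) n"
    by (simp only: cinner_unit_vec_right)
qed

lemma adjoint_exists:
  assumes X: "X \<in> bounded_ops"
  shows "\<exists>Y::ell2 \<Rightarrow>\<^sub>L ell2. Y \<in> bounded_ops \<and> (\<forall>x y. cinner (X x) y = cinner x (Y y))"
proof -
  define g where "g y = Abs_ell2 (\<lambda>n. cinner y (X (unit_vec n)))" for y
  have coord_g: "coord (g y) n = cinner y (X (unit_vec n))" for y n
    unfolding g_def by (subst Abs_ell2_inverse) (auto simp: square_summable_adjoint_coords[OF X])
  have adj: "cinner (X x) y = cinner x (g y)" for x y
  proof -
    have "(\<lambda>n. cinner (X (scaleC (coord x n) (unit_vec n))) y) sums cinner (X x) y"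
      by (intro bounded_linear.sums[OF bounded_linear_cinner_left]
          bounded_linear.sums[OF blinfun.bounded_linear_right] unit_vec_expansion)
    moreover have "cinner (X (scaleC (coord x n) (unit_vec n))) y = coord x n * cnj (coord (g y) n)" for n
    proof -
      have "X (scaleC (coord x n) (unit_vec n)) = scaleC (coord x n) (X (unit_vec n))"
        using X unfolding bounded_ops_def by blast
      then show ?thesis
        by (simp only: cinner_scaleC_left coord_g cinner_commute[symmetric])
    qed
    ultimately show ?thesis
      by (simp add: cinner_def[of x "g y"] sums_iff)
  qed
  have bl: "bounded_linear g"
  proof
    show "g (x + y) = g x + g y" for x y
      by (rule ell2_eqI) (simp add: coord_g plus_ell2.rep_eq cinner_add_left)
    show "g (r *\<^sub>R x) = r *\<^sub>R g x" for r x
      by (rule ell2_eqI)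
        (simp only: coord_g scaleR_eq_scaleC scaleC.rep_eq cinner_scaleC_left)
    have "norm (g y) \<le> norm y * norm X" for y
    proof -
      have "(norm (g y))\<^sup>2 = (\<Sum>n. (cmod (coord (g y) n))\<^sup>2)"
        by (rule norm_ell2_square)
      also have "\<dots> \<le> (norm X * norm y)\<^sup>2"
        unfolding coord_g by (rule square_summable_adjoint_coords(2)[OF X])
      finally have "norm (g y) \<le> norm X * norm y"
        by (rule power2_le_imp_le) simp
      then show ?thesis by (simp only: mult.commute)
    qed
    then show "\<exists>K. \<forall>y. norm (g y) \<le> norm y * K" by blast
  qed
  have "Blinfun g \<in> bounded_ops"
    unfolding bounded_ops_def mem_Collect_eq bounded_linear_Blinfun_apply[OF bl]
    by (intro allI ell2_eqI) (simp only: coord_g scaleC.rep_eq cinner_scaleC_left)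
  then show ?thesis
    using adj by (intro exI[of _ "Blinfun g"]) (simp only: bounded_linear_Blinfun_apply[OF bl] simp_thms)
qed

lemma adj_in_bounded_ops: "X \<in> bounded_ops \<Longrightarrow> adj X \<in> bounded_ops"
  and cinner_adj: "X \<in> bounded_ops \<Longrightarrow> cinner (X x) y = cinner x (adj X y)"
proof -
  assume "X \<in> bounded_ops"
  then obtain Y where Y: "Y \<in> bounded_ops" "\<forall>x y. cinner (X x) y = cinner x (Y y)"
    using adjoint_exists by blast
  then have "adj X = Y"
    unfolding adj_def using adjoint_unique by (intro the_equality) blast+
  then show "adj X \<in> bounded_ops" and "cinner (X x) y = cinner x (adj X y)"
    using Y by auto
qed


lemma bounded_diagonal_entries: "bounded (range (\<lambda>n. entry X n n))"
proof -
  have "cmod (entry X n n) \<le> norm X" for n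
  proof -
    have "(norm (unit_vec n))\<^sup>2 = (\<Sum>k. if k = n then 1 else 0 :: real)"
      unfolding norm_ell2_square
      by (rule arg_cong[where f = suminf]) (auto simp: unit_vec.rep_eq)
    also have "\<dots> = 1"
      using sums_single[of n "\<lambda>_. 1 :: real"] by (simp add: sums_iff)
    finally have "norm (unit_vec n) = 1"
      using power2_eq_iff_nonneg[of "norm (unit_vec n)" 1] by simp
    then show ?thesis
      using cinner_cauchy_schwarz[of "X (unit_vec n)" "unit_vec n"] norm_blinfun[of X "unit_vec n"]
      unfolding entry_def by simp
  qed
  then show ?thesis
    unfolding bounded_iff by auto
qed


section \<open>The Stone-Cech compactification of the natural numbers\<close>

text \<open>Its points are the ultrafilters on the natural numbers, with the topology generated by the
  sets of all ultrafilters containing a given set of natural numbers.\<close>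

typedef betaN = "{F :: nat filter. F \<noteq> bot \<and> (\<forall>P. eventually P F \<or> eventually (\<lambda>n. \<not> P n) F)}"
  morphisms ultrafilter Abs_betaN
  by (rule exI[of _ "principal {0}"]) (auto simp: eventually_principal principal_eq_bot_iff)

definition basic_set :: "nat set \<Rightarrow> betaN set"
  where "basic_set A = {\<omega>. \<forall>\<^sub>F n in ultrafilter \<omega>. n \<in> A}"

instantiation betaN :: topological_space
begin
definition open_betaN :: "betaN set \<Rightarrow> bool"
  where "open_betaN = generate_topology (range basic_set)"
instance
  by standard (auto simp: open_betaN_def intro: generate_topology.intros)
end

definition nat_to_beta :: "nat \<Rightarrow> betaN"
  where "nat_to_beta n = Abs_betaN (principal {n})"

definition beta_extension :: "(nat \<Rightarrow> complex) \<Rightarrow> betaN \<Rightarrow> complex"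
  where "beta_extension f = (THE g. continuous_on UNIV g \<and> (\<forall>n. g (nat_to_beta n) = f n))"


subsection \<open>Existence and uniqueness of continuous extensions\<close>

lemma ultrafilter_nat_to_beta: "ultrafilter (nat_to_beta n) = principal {n}"
  unfolding nat_to_beta_def
  by (subst Abs_betaN_inverse) (auto simp: eventually_principal principal_eq_bot_iff)

lemma ultrafilter_not_bot: "ultrafilter \<omega> \<noteq> bot"
  and ultrafilter_cases: "eventually P (ultrafilter \<omega>) \<or> eventually (\<lambda>n. \<not> P n) (ultrafilter \<omega>)"
  using ultrafilter[of \<omega>] by auto

lemma open_basic_set: "open (basic_set A)"
  unfolding open_betaN_def by (rule generate_topology.Basis) simp

lemma open_betaN_basic:
  assumes "open U" and "\<omega> \<in> U"
  obtains A where "\<omega> \<in> basic_set A" and "basic_set A \<subseteq> U"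
proof -
  have "generate_topology (range basic_set) U"
    using assms(1) by (simp add: open_betaN_def)
  then have "\<forall>\<omega>\<in>U. \<exists>A. \<omega> \<in> basic_set A \<and> basic_set A \<subseteq> U"
  proof induction
    case UNIV
    then show ?case by (auto simp: basic_set_def intro!: exI[of _ UNIV])
  next
    case (Int U V)
    show ?case
    proof
      fix \<omega> assume "\<omega> \<in> U \<inter> V"
      then obtain A B where "\<omega> \<in> basic_set A" "basic_set A \<subseteq> U" "\<omega> \<in> basic_set B" "basic_set B \<subseteq> V"
        using Int.IH by (metis IntD1 IntD2)
      moreover have "basic_set (A \<inter> B) = basic_set A \<inter> basic_set B"
        by (auto simp: basic_set_def eventually_conj_iff)
      ultimately show "\<exists>C. \<omega> \<in> basic_set C \<and> basic_set C \<subseteq> U \<inter> V"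
        by (intro exI[of _ "A \<inter> B"]) auto
    qed
  next
    case (UN K)
    then show ?case by (meson Union_iff Union_upper order_trans)
  next
    case (Basis S)
    then show ?case by blast
  qed
  then show ?thesis using that assms(2) by blast
qed

lemma ultrafilter_limit_exists:
  fixes f :: "nat \<Rightarrow> complex"
  assumes "bounded (range f)"
  shows "\<exists>l. (f \<longlongrightarrow> l) (ultrafilter \<omega>)"
proof -
  let ?F = "filtermap f (ultrafilter \<omega>)"
  have "compact (closure (range f))"
    using assms by (simp add: compact_closure)
  moreover have "?F \<noteq> bot"
    by (simp add: filtermap_bot_iff ultrafilter_not_bot)
  moreover have "eventually (\<lambda>z. z \<in> closure (range f)) ?F"
    using closure_subset[of "range f"] by (auto simp: eventually_filtermap intro!: always_eventually)
  ultimately obtain l where l: "inf (nhds l) ?F \<noteq> bot"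
    unfolding compact_filter by blast
  have "(f \<longlongrightarrow> l) (ultrafilter \<omega>)"
  proof (rule topological_tendstoI)
    fix S assume "open S" "l \<in> S"
    show "eventually (\<lambda>n. f n \<in> S) (ultrafilter \<omega>)"
    proof (rule ccontr)
      assume "\<not> eventually (\<lambda>n. f n \<in> S) (ultrafilter \<omega>)"
      then have "eventually (\<lambda>z. z \<notin> S) ?F"
        using ultrafilter_cases[of "\<lambda>n. f n \<in> S" \<omega>] by (simp add: eventually_filtermap)
      moreover have "eventually (\<lambda>z. z \<in> S) (nhds l)"
        using \<open>open S\<close> \<open>l \<in> S\<close> by (rule eventually_nhds_in_open)
      ultimately have "eventually (\<lambda>_. False) (inf (nhds l) ?F)"
        unfolding eventually_inf by blast
      with l show False by (simp add: trivial_limit_def)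
    qed
  qed
  then show ?thesis ..
qed

lemma nat_to_beta_dense:
  assumes "open U" and "\<omega> \<in> U"
  shows "\<exists>n. nat_to_beta n \<in> U"
proof -
  obtain A where A: "\<omega> \<in> basic_set A" "basic_set A \<subseteq> U"
    using open_betaN_basic[OF assms] .
  then have "\<forall>\<^sub>F n in ultrafilter \<omega>. n \<in> A"
    by (simp add: basic_set_def)
  then obtain n where "n \<in> A"
    using eventually_happens'[OF ultrafilter_not_bot] by blast
  then have "nat_to_beta n \<in> basic_set A"
    by (simp add: basic_set_def ultrafilter_nat_to_beta eventually_principal)
  then show ?thesis using A by blast
qed

lemma continuous_extension_unique:
  fixes g h :: "betaN \<Rightarrow> complex"
  assumes "continuous_on UNIV g" and "continuous_on UNIV h"
    and "\<forall>n. g (nat_to_beta n) = h (nat_to_beta n)"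
  shows "g = h"
proof (rule ccontr)
  assume "g \<noteq> h"
  then obtain \<omega> where "g \<omega> \<noteq> h \<omega>" by blast
  moreover have "open {\<omega>. g \<omega> \<noteq> h \<omega>}"
    using assms(1,2) by (rule open_Collect_neq)
  ultimately show False
    using nat_to_beta_dense[of "{\<omega>. g \<omega> \<noteq> h \<omega>}" \<omega>] assms(3) by auto
qed

lemma beta_extension_bounded:
  assumes "bounded (range f)"
  shows "continuous_on UNIV (beta_extension f)"
    and "beta_extension f (nat_to_beta n) = f n"
    and "(f \<longlongrightarrow> beta_extension f \<omega>) (ultrafilter \<omega>)"
proof -
  obtain g where g: "\<And>\<omega>. (f \<longlongrightarrow> g \<omega>) (ultrafilter \<omega>)"
    using choice[of "\<lambda>\<omega> l. (f \<longlongrightarrow> l) (ultrafilter \<omega>)"] ultrafilter_limit_exists[OF assms]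
    by blast
  have cont: "continuous_on UNIV g"
  proof (subst continuous_on_open_vimage[OF open_UNIV], intro allI impI)
    fix B :: "complex set" assume "open B"
    have nbhd: "\<exists>T. open T \<and> \<omega> \<in> T \<and> T \<subseteq> g -` B" if gB: "g \<omega> \<in> B" for \<omega>
    proof -
      obtain e where e: "e > 0" "cball (g \<omega>) e \<subseteq> B"
        using open_contains_cball[of B] \<open>open B\<close> gB by blast
      let ?A = "{n. f n \<in> cball (g \<omega>) e}"
      have "eventually (\<lambda>n. f n \<in> ball (g \<omega>) e) (ultrafilter \<omega>)"
        using e(1) by (intro topological_tendstoD[OF g]) simp_all
      then have "eventually (\<lambda>n. f n \<in> cball (g \<omega>) e) (ultrafilter \<omega>)"
        by (rule eventually_mono) simp
      then have "\<omega> \<in> basic_set ?A"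
        by (simp add: basic_set_def)
      moreover have "basic_set ?A \<subseteq> g -` B"
      proof
        fix \<tau> assume "\<tau> \<in> basic_set ?A"
        then have "eventually (\<lambda>n. f n \<in> cball (g \<omega>) e) (ultrafilter \<tau>)"
          by (simp only: basic_set_def mem_Collect_eq)
        then have "g \<tau> \<in> cball (g \<omega>) e"
          by (rule Lim_in_closed_set[OF closed_cball _ ultrafilter_not_bot g])
        then show "\<tau> \<in> g -` B"
          using e(2) by blast
      qed
      ultimately show ?thesis
        by (intro exI[of _ "basic_set ?A"] conjI open_basic_set)
    qed
    show "open (g -` B \<inter> UNIV)"
      unfolding Int_UNIV_right open_subopen[of "g -` B"]
      by (intro ballI nbhd) (simp only: vimage_eq)
  qed
  have ext: "g (nat_to_beta n) = f n" for n
  proof -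
    have "(f \<longlongrightarrow> f n) (ultrafilter (nat_to_beta n))"
      by (rule topological_tendstoI) (simp add: ultrafilter_nat_to_beta eventually_principal)
    then show ?thesis
      by (rule tendsto_unique[OF ultrafilter_not_bot g])
  qed
  have "beta_extension f = g"
    unfolding beta_extension_def
  proof (rule the_equality)
    show "continuous_on UNIV g \<and> (\<forall>n. g (nat_to_beta n) = f n)"
      using cont ext by blast
    show "h = g" if "continuous_on UNIV h \<and> (\<forall>n. h (nat_to_beta n) = f n)" for h
      using that cont ext by (intro continuous_extension_unique) simp_all
  qed
  then show "continuous_on UNIV (beta_extension f)" "beta_extension f (nat_to_beta n) = f n"
    "(f \<longlongrightarrow> beta_extension f \<omega>) (ultrafilter \<omega>)"
    by (simp_all only: cont ext g)
qed


section \<open>States and the Kadison-Singer conjecture\<close>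

definition state :: "((ell2 \<Rightarrow>\<^sub>L ell2) \<Rightarrow> complex) \<Rightarrow> bool"
  where "state \<phi> \<longleftrightarrow>
    (\<forall>X\<in>bounded_ops. \<forall>Y\<in>bounded_ops. \<phi> (X + Y) = \<phi> X + \<phi> Y) \<and>
    (\<forall>c. \<forall>X\<in>bounded_ops. \<phi> (scaleC_op c X) = c * \<phi> X) \<and>
    (\<forall>X\<in>bounded_ops. positive_op X \<longrightarrow> \<phi> X \<in> \<real>\<^sub>\<ge>\<^sub>0) \<and>
    \<phi> id_blinfun = 1"

text \<open>A diagonal operator is identified with the continuous extension of its (bounded) sequence of
  diagonal entries, and the extension is evaluated at the given point.\<close>

definition eval_state :: "betaN \<Rightarrow> (ell2 \<Rightarrow>\<^sub>L ell2) \<Rightarrow> complex"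
  where "eval_state \<omega> D = beta_extension (\<lambda>n. entry D n n) \<omega>"

definition state_extension :: "betaN \<Rightarrow> ((ell2 \<Rightarrow>\<^sub>L ell2) \<Rightarrow> complex) \<Rightarrow> bool"
  where "state_extension \<omega> \<phi> \<longleftrightarrow> state \<phi> \<and> (\<forall>D\<in>diagonal_ops. \<phi> D = eval_state \<omega> D)"

text \<open>Functionals are total functions on \<^typ>\<open>ell2 \<Rightarrow>\<^sub>L ell2\<close>, so that uniqueness of an extension
  means agreement on \<^const>\<open>bounded_ops\<close>.\<close>

definition kadison_singer :: bool
  where "kadison_singer \<longleftrightarrow>
    (\<forall>\<omega>. \<exists>\<phi>. state_extension \<omega> \<phi> \<and>
      (\<forall>\<psi>. state_extension \<omega> \<psi> \<longrightarrow> (\<forall>X\<in>bounded_ops. \<psi> X = \<phi> X)))"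


section \<open>Paving conditions for strictly upper triangular operators\<close>

definition upper_sym_paving :: bool
  where "upper_sym_paving \<longleftrightarrow>
    (\<forall>T\<in>strictly_upper_ops. \<forall>\<epsilon>::real. \<epsilon> > 0 \<longrightarrow>
      (\<exists>r A. paving r A \<and> (\<forall>i\<in>{1..r}.
        - (\<epsilon> *\<^sub>R diag_proj (A i)) \<preceq> diag_proj (A i) o\<^sub>L (T + adj T) o\<^sub>L diag_proj (A i) \<and>
        diag_proj (A i) o\<^sub>L (T + adj T) o\<^sub>L diag_proj (A i) \<preceq> \<epsilon> *\<^sub>R diag_proj (A i))))"

definition upper_norm_paving :: bool
  where "upper_norm_paving \<longleftrightarrow>
    (\<forall>T\<in>strictly_upper_ops. \<forall>\<epsilon>::real. \<epsilon> > 0 \<longrightarrow>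
      (\<exists>r A. paving r A \<and> (\<forall>i\<in>{1..r}.
        norm (diag_proj (A i) o\<^sub>L T o\<^sub>L diag_proj (A i)) < \<epsilon>)))"

end

theory Submission
  imports Defs
begin

text \<open>
  The implication from the paving of strictly upper triangular operators to the Kadison-Singer
  conjecture is the substantial one. Paving forces every extension \<open>\<phi>\<close> of \<open>s\<^sub>\<omega>\<close> to vanish on strictly
  upper triangular operators, so all extensions agree on upper triangular ones. If \<open>P\<close> is positive
  and invertible, Gram-Schmidt for the form \<open>\<langle>P x, y\<rangle>\<close> gives an upper triangular \<open>U\<close> with \<open>P = U\<^sup>* U\<close> and
  an upper triangular inverse \<open>V\<close>, so \<open>\<phi>(P) \<ge> \<bar>\<phi>(U)\<bar>\<^sup>2\<close> and \<open>\<psi>(P\<^sup>-\<^sup>1) \<ge> \<bar>\<psi>(V)\<bar>\<^sup>2\<close> for any two extensions,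
  and the product of the right-hand sides is \<open>1\<close>. For \<open>P = 1 + t H\<close> with \<open>H\<close> self-adjoint, comparing the
  terms of first order in \<open>t\<close> in \<open>\<phi>(P) \<psi>(P\<^sup>-\<^sup>1) \<ge> 1\<close> yields \<open>\<phi>(H) = \<psi>(H)\<close>. The
  factorization is needed because triangular truncation is unbounded: \<open>H\<close> itself need not be a sum of
  bounded triangular operators.

  Conversely, if \<open>T\<close> has zero diagonal and for some \<open>\<omega>\<close> no set in \<open>\<omega>\<close> makes the compression of \<open>T\<close>
  small, then a limit of vector states supported on the sets in \<open>\<omega>\<close> extends \<open>s\<^sub>\<omega>\<close> and does not vanish
  at \<open>T\<close>, whereas evaluating the diagonal at \<open>\<omega>\<close> gives an extension that does. Compactness of \<open>\<beta>\<nat>\<close>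
  turns the small sets into a paving.
\<close>

section \<open>Ultrafilters\<close>

text \<open>The condition defining \<open>betaN\<close>, over an arbitrary type: limits of vector
  states are taken along ultrafilters on \<open>ell2\<close>.\<close>

definition ultra :: "'a filter \<Rightarrow> bool"
  where "ultra U \<longleftrightarrow> U \<noteq> bot \<and> (\<forall>P. eventually P U \<or> eventually (\<lambda>x. \<not> P x) U)"

lemma ultra_ultrafilter: "ultra (ultrafilter \<omega>)"
  using ultrafilter[of \<omega>] by (simp add: ultra_def)

lemma ultra_filtermap: "ultra U \<Longrightarrow> ultra (filtermap f U)"
  by (simp add: ultra_def filtermap_bot_iff eventually_filtermap)

lemma ultrafilter_finite_Union:
  assumes "ultra U" and "finite I" and "eventually (\<lambda>x. \<exists>i\<in>I. P i x) U"
  shows "\<exists>i\<in>I. eventually (P i) U"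
proof (rule ccontr)
  assume "\<not> ?thesis"
  then have "\<forall>i\<in>I. eventually (\<lambda>x. \<not> P i x) U"
    using assms(1) by (auto simp: ultra_def)
  then have "eventually (\<lambda>x. \<forall>i\<in>I. \<not> P i x) U"
    using assms(2) by (simp add: eventually_ball_finite)
  with assms(3) have "eventually (\<lambda>_. False) U"
    by eventually_elim auto
  then show False using assms(1) by (simp add: ultra_def trivial_limit_def)
qed

text \<open>A chain is directed downwards, so whatever holds eventually for its infimum already
  holds eventually for one member. This supplies the bound in Zorn's lemma.\<close>

lemma chain_Inf_filter_not_bot:
  assumes ne: "C \<noteq> {}" and nb: "\<forall>F\<in>C. F \<noteq> bot" and ch: "\<forall>F\<in>C. \<forall>G\<in>C. F \<le> G \<or> G \<le> F"
  shows "Inf C \<noteq> (bot :: 'a filter)"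
proof
  assume "Inf C = bot"
  then have "eventually (\<lambda>_. False) (Inf C)"
    by simp
  moreover have "\<exists>x\<in>C. x \<le> F \<and> x \<le> G" if "F \<in> C" "G \<in> C" for F G
    using ch that by (meson order_refl)
  ultimately have "\<exists>F\<in>C. eventually (\<lambda>_. False) F"
    using eventually_Inf_base[OF ne] by (simp add: le_inf_iff)
  then show False
    using nb by (simp add: trivial_limit_def)
qed

text \<open>Zorn's lemma, ordered so that its maximal elements are the minimal proper filters below
  \<open>F\<close>; minimality forces each predicate to be decided.\<close>

lemma ultrafilter_exists:
  assumes "F \<noteq> (bot :: 'a filter)"
  shows "\<exists>U\<le>F. ultra U"
proof -
  let ?A = "{G. G \<noteq> bot \<and> G \<le> F}"
  have "\<exists>M\<in>?A. \<forall>G\<in>?A. M \<ge> G \<longrightarrow> G = M"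
  proof (rule predicate_Zorn)
    show "partial_order_on ?A (relation_of (\<ge>) ?A)"
      by (auto simp: partial_order_on_def preorder_on_def refl_on_def trans_def antisym_def
          relation_of_def)
    fix C assume C: "C \<in> Chains (relation_of (\<ge>) ?A)"
    then have sub: "C \<subseteq> ?A" and ch: "\<forall>G\<in>C. \<forall>G'\<in>C. G \<le> G' \<or> G' \<le> G"
      by (auto simp: Chains_def relation_of_def)
    show "\<exists>M\<in>?A. \<forall>G\<in>C. G \<ge> M"
    proof (cases "C = {}")
      case True
      then show ?thesis using assms by auto
    next
      case False
      have "Inf C \<noteq> bot"
        using sub by (intro chain_Inf_filter_not_bot False ch) auto
      moreover have "Inf C \<le> F"
        using False sub by (auto intro: Inf_lower2)
      ultimately show ?thesis
        by (intro bexI[of _ "Inf C"]) (auto intro: Inf_lower)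
    qed
  qed
  then obtain M where M: "M \<noteq> bot" "M \<le> F" and max: "\<And>G. G \<noteq> bot \<Longrightarrow> G \<le> F \<Longrightarrow> G \<le> M \<Longrightarrow> G = M"
    by auto
  have "eventually P M" if "\<not> eventually (\<lambda>x. \<not> P x) M" for P
  proof -
    \<comment> \<open>Adjoining \<open>{x. P x}\<close> keeps the filter proper because its
      complement is not in \<open>M\<close>; by minimality nothing new was added.\<close>
    let ?G = "inf M (principal {x. P x})"
    have "?G = M"
    proof (rule max)
      show "?G \<noteq> bot"
        using that by (simp add: trivial_limit_def eventually_inf_principal)
      show "?G \<le> F" "?G \<le> M"
        using M(2) by (simp_all add: le_infI1)
    qed
    moreover have "eventually P ?G"
      by (simp add: eventually_inf_principal)
    ultimately show ?thesis by simp
  qed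
  then show ?thesis
    using M unfolding ultra_def by blast
qed

text \<open>The image filter lives on a compact ball and so has a cluster point; as \<open>U\<close>
  decides whether \<open>f x\<close> lies in a given open set, a cluster point is a limit.\<close>

lemma ultra_limit_exists:
  fixes f :: "'a \<Rightarrow> complex"
  assumes "ultra U" and "eventually (\<lambda>x. cmod (f x) \<le> b) U"
  shows "\<exists>l. (f \<longlongrightarrow> l) U"
proof -
  let ?F = "filtermap f U"
  have "?F \<noteq> bot" and "eventually (\<lambda>z. z \<in> cball 0 b) ?F"
    using assms by (simp_all add: filtermap_bot_iff ultra_def eventually_filtermap)
  then obtain l where l: "inf (nhds l) ?F \<noteq> bot"
    using compact_cball[of "0 :: complex" b] unfolding compact_filter by blast
  have "(f \<longlongrightarrow> l) U"
  proof (rule topological_tendstoI)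
    fix S assume S: "open S" "l \<in> S"
    show "eventually (\<lambda>x. f x \<in> S) U"
    proof (rule ccontr)
      assume "\<not> ?thesis"
      then have "eventually (\<lambda>z. z \<notin> S) ?F"
        using assms(1) unfolding ultra_def eventually_filtermap by blast
      moreover have "eventually (\<lambda>z. z \<in> S) (nhds l)"
        using S by (rule eventually_nhds_in_open)
      ultimately have "eventually (\<lambda>_. False) (inf (nhds l) ?F)"
        unfolding eventually_inf by blast
      with l show False by (simp add: trivial_limit_def)
    qed
  qed
  then show ?thesis ..
qed

text \<open>Compactness of the space of ultrafilters: without a finite subcover the complements have
  the finite intersection property, and an ultrafilter containing all of them contradicts the
  hypothesis.\<close>

lemma betaN_compact_cover:
  assumes "\<And>\<omega>. \<exists>A\<in>\<G>. \<forall>\<^sub>F n in ultrafilter \<omega>. n \<in> A"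
  obtains \<F> where "finite \<F>" and "\<F> \<subseteq> \<G>" and "\<Union>\<F> = UNIV"
proof -
  have "\<exists>\<F>. finite \<F> \<and> \<F> \<subseteq> \<G> \<and> \<Union>\<F> = UNIV"
  proof (rule ccontr)
    assume none: "\<not> ?thesis"
    define F where "F = (INF A\<in>\<G>. principal (- A))"
    have "F \<noteq> bot"
      unfolding F_def
    proof (rule INF_filter_not_bot)
      fix \<F> assume "\<F> \<subseteq> \<G>" and fin: "finite \<F>"
      then have "\<Union>\<F> \<noteq> UNIV"
        using none by blast
      then have "(\<Inter>A\<in>\<F>. - A) \<noteq> {}"
        by auto
      then show "(INF A\<in>\<F>. principal (- A)) \<noteq> bot"
        by (simp add: INF_principal_finite[OF fin] principal_eq_bot_iff)
    qed
    then obtain U where U: "U \<le> F" "ultra U"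
      using ultrafilter_exists by blast
    then have ultra: "ultrafilter (Abs_betaN U) = U"
      by (subst Abs_betaN_inverse) (auto simp: ultra_def)
    obtain A where A: "A \<in> \<G>" "\<forall>\<^sub>F n in U. n \<in> A"
      using assms[of "Abs_betaN U"] unfolding ultra by blast
    have "\<forall>\<^sub>F n in U. n \<in> - A"
      using U(1) A(1) unfolding F_def
      by (auto intro!: filter_leD[OF U(1)] eventually_INF1 simp: F_def eventually_principal)
    with A(2) have "eventually (\<lambda>_. False) U"
      by eventually_elim auto
    then show False
      using U(2) by (simp add: ultra_def trivial_limit_def)
  qed
  then show ?thesis by (elim exE conjE) (rule that)
qed


section \<open>Bounded operators\<close>

lemma scaleC_add_right: "scaleC c (x + y) = scaleC c x + scaleC c y"
  by transfer (simp add: distrib_left)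

lemma scaleC_diff_right: "scaleC c (x - y) = scaleC c x - scaleC c y"
  by transfer (simp add: right_diff_distrib)

lemma scaleC_scaleC: "scaleC c (scaleC d x) = scaleC (c * d) x"
  by transfer (simp add: mult.assoc)

lemma scaleC_one [simp]: "scaleC 1 x = x"
  by transfer simp

lemma scaleC_zero_left [simp]: "scaleC 0 x = 0"
  by transfer simp

lemma scaleC_minus_right: "scaleC c (- x) = - scaleC c x"
  by transfer simp

lemma scaleC_minus_left: "scaleC (- c) x = - scaleC c x"
  by transfer simp

lemma cinner_minus_left: "cinner (- x) y = - cinner x y"
  using cinner_scaleC_left[of "-1" x y] by (simp add: scaleC_minus_left)

lemma cinner_minus_right: "cinner x (- y) = - cinner x y"
  by (simp add: cinner_commute[of x] cinner_minus_left)

lemma cinner_diff_left: "cinner (x - y) z = cinner x z - cinner y z"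
  using cinner_add_left[of x "- y" z] by (simp add: cinner_minus_left)

lemma cinner_diff_right: "cinner x (y - z) = cinner x y - cinner x z"
  by (simp add: cinner_commute[of x] cinner_diff_left)

lemma cinner_zero_left [simp]: "cinner 0 y = 0"
  using cinner_scaleC_left[of 0 0 y] by simp

lemma cinner_zero_right [simp]: "cinner x 0 = 0"
  by (simp add: cinner_commute[of x])

lemma cinner_sum_left: "cinner (\<Sum>i\<in>I. f i) y = (\<Sum>i\<in>I. cinner (f i) y)"
  by (rule linear_sum[OF bounded_linear.linear[OF bounded_linear_cinner_left]])

lemma cinner_sum_right: "cinner x (\<Sum>i\<in>I. f i) = (\<Sum>i\<in>I. cinner x (f i))"
  by (simp add: cinner_commute[of x] cinner_sum_left)

lemmas cinner_linear =
  cinner_add_left cinner_add_right cinner_diff_left cinner_diff_right cinner_minus_left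
  cinner_minus_right cinner_scaleC_left cinner_scaleC_right

lemma cinner_self_nonneg_Reals: "cinner x x \<in> \<real>\<^sub>\<ge>\<^sub>0"
  by (simp add: cinner_self)

lemma norm_unit_vec [simp]: "norm (unit_vec n) = 1"
proof -
  have "of_real ((norm (unit_vec n))\<^sup>2) = coord (unit_vec n) n"
    by (simp only: cinner_self[symmetric] cinner_unit_vec_right)
  then have "(norm (unit_vec n))\<^sup>2 = 1"
    by (simp add: unit_vec.rep_eq del: of_real_power)
  then show ?thesis
    using power2_eq_iff_nonneg[of "norm (unit_vec n)" 1] by simp
qed

lemma entry_eq_coord: "entry X i j = coord (X (unit_vec j)) i"
  by (simp add: entry_def cinner_unit_vec_right)

lemma bounded_ops_scaleC: "X \<in> bounded_ops \<Longrightarrow> blinfun_apply X (scaleC c x) = scaleC c (blinfun_apply X x)"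
  by (simp add: bounded_ops_def)

lemma bounded_ops_closed:
  shows "id_blinfun \<in> bounded_ops"
    and "X \<in> bounded_ops \<Longrightarrow> Y \<in> bounded_ops \<Longrightarrow> X + Y \<in> bounded_ops"
    and "X \<in> bounded_ops \<Longrightarrow> Y \<in> bounded_ops \<Longrightarrow> X - Y \<in> bounded_ops"
    and "X \<in> bounded_ops \<Longrightarrow> - X \<in> bounded_ops"
    and "X \<in> bounded_ops \<Longrightarrow> Y \<in> bounded_ops \<Longrightarrow> X o\<^sub>L Y \<in> bounded_ops"
    and "X \<in> bounded_ops \<Longrightarrow> scaleC_op c X \<in> bounded_ops"
    and "X \<in> bounded_ops \<Longrightarrow> adj X \<in> bounded_ops"
    and "diag_proj A \<in> bounded_ops"
proof -
  show "diag_proj A \<in> bounded_ops"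
    unfolding bounded_ops_def
    by (auto intro!: ell2_eqI simp: diag_proj_apply restrict_coords.rep_eq scaleC.rep_eq)
  show "X \<in> bounded_ops \<Longrightarrow> adj X \<in> bounded_ops"
    by (rule adj_in_bounded_ops)
qed (simp_all add: bounded_ops_def blinfun.bilinear_simps scaleC_add_right scaleC_diff_right
    scaleC_minus_right scaleC_op_apply scaleC_scaleC mult.commute)

lemma scaleR_eq_scaleC_op: "r *\<^sub>R X = scaleC_op (of_real r) X"
  by (intro blinfun_eqI) (simp add: scaleC_op_apply scaleR_blinfun.rep_eq scaleR_eq_scaleC)

lemma bounded_ops_scaleR: "X \<in> bounded_ops \<Longrightarrow> r *\<^sub>R X \<in> bounded_ops"
  by (simp add: scaleR_eq_scaleC_op bounded_ops_closed)

lemma cinner_adj_left: "X \<in> bounded_ops \<Longrightarrow> cinner (adj X x) y = cinner x (X y)"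
  using cinner_adj[of X y x] by (metis cinner_commute)

lemma adj_eqI:
  fixes Y :: "ell2 \<Rightarrow>\<^sub>L ell2"
  assumes "X \<in> bounded_ops" and "\<And>x y. cinner (X x) y = cinner x (Y y)"
  shows "adj X = Y"
  by (rule adjoint_unique[of X]) (simp_all add: assms(2) cinner_adj[OF assms(1), symmetric])

lemma adj_id [simp]: "adj id_blinfun = id_blinfun"
  by (rule adj_eqI) (simp_all add: bounded_ops_closed)

lemma adj_adj: "X \<in> bounded_ops \<Longrightarrow> adj (adj X) = X"
  by (rule adj_eqI) (simp_all add: bounded_ops_closed cinner_adj_left)

lemma adj_scaleC_op: "X \<in> bounded_ops \<Longrightarrow> adj (scaleC_op c X) = scaleC_op (cnj c) (adj X)"
  by (rule adj_eqI) (simp_all add: bounded_ops_closed scaleC_op_apply cinner_linear cinner_adj)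

lemma adj_simps:
  assumes "X \<in> bounded_ops" and "Y \<in> bounded_ops"
  shows "adj (X + Y) = adj X + adj Y"
    and "adj (X - Y) = adj X - adj Y"
    and "adj (X o\<^sub>L Y) = adj Y o\<^sub>L adj X"
  using assms by (auto intro!: adj_eqI
      simp: bounded_ops_closed blinfun.bilinear_simps cinner_linear cinner_adj)

lemma comp_id [simp]: "X o\<^sub>L id_blinfun = X" "id_blinfun o\<^sub>L X = X"
  by (simp_all add: blinfun_eqI)

lemma self_adjointI:
  assumes "X \<in> bounded_ops" and "adj X = X"
  shows "cinner (X x) y = cinner x (X y)"
  using cinner_adj[OF assms(1), of x y] assms(2) by simp

lemma bounded_ops_eqI:
  assumes "X \<in> bounded_ops" and "Y \<in> bounded_ops"
    and "\<And>n. blinfun_apply X (unit_vec n) = blinfun_apply Y (unit_vec n)"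
  shows "X = Y"
proof (rule blinfun_eqI)
  fix x
  have "(\<lambda>n. Z (scaleC (coord x n) (unit_vec n))) sums Z x" for Z :: "ell2 \<Rightarrow>\<^sub>L ell2"
    by (intro bounded_linear.sums[OF blinfun.bounded_linear_right] unit_vec_expansion)
  from this[of X] this[of Y] show "X x = Y x"
    using assms by (simp add: bounded_ops_scaleC sums_iff)
qed

lemma bounded_ops_eq_entryI:
  assumes "X \<in> bounded_ops" and "Y \<in> bounded_ops" and "\<And>i j. entry X i j = entry Y i j"
  shows "X = Y"
  using assms by (intro bounded_ops_eqI ell2_eqI) (auto simp: entry_eq_coord)

lemma entry_simps:
  "entry (X + Y) i j = entry X i j + entry Y i j"
  "entry (X - Y) i j = entry X i j - entry Y i j"
  "entry (scaleC_op c X) i j = c * entry X i j"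
  "entry id_blinfun i j = (if i = j then 1 else 0)"
  by (simp_all add: entry_def blinfun.bilinear_simps cinner_linear scaleC_op_apply)
    (simp add: cinner_unit_vec_right unit_vec.rep_eq)

section \<open>Diagonal operators and coordinate projections\<close>

lemma norm_le_coordwise:
  assumes "b \<ge> 0" and le: "\<And>n. cmod (coord y n) \<le> b * cmod (coord x n)"
  shows "norm y \<le> b * norm x"
proof (rule power2_le_imp_le)
  have "(\<Sum>n. (cmod (coord y n))\<^sup>2) \<le> (\<Sum>n. b\<^sup>2 * (cmod (coord x n))\<^sup>2)"
  proof (rule suminf_le[OF _ summable_coord summable_mult[OF summable_coord]])
    show "(cmod (coord y n))\<^sup>2 \<le> b\<^sup>2 * (cmod (coord x n))\<^sup>2" for n
      using power_mono[OF le, of n 2] by (simp add: power_mult_distrib)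
  qed
  then show "(norm y)\<^sup>2 \<le> (b * norm x)\<^sup>2"
    by (simp add: norm_ell2_square power_mult_distrib suminf_mult summable_coord)
  show "0 \<le> b * norm x"
    using \<open>b \<ge> 0\<close> by simp
qed

text \<open>The value zero for unbounded \<open>d\<close> makes the map total: only bounded
  multipliers preserve square summability of every sequence.\<close>

lift_definition mult_coords :: "(nat \<Rightarrow> complex) \<Rightarrow> ell2 \<Rightarrow> ell2"
  is "\<lambda>d x n. if bounded (range d) then d n * x n else 0"
proof -
  fix d x :: "nat \<Rightarrow> complex"
  assume x: "summable (\<lambda>n. (cmod (x n))\<^sup>2)"
  show "summable (\<lambda>n. (cmod (if bounded (range d) then d n * x n else 0))\<^sup>2)"
  proof (cases "bounded (range d)")
    case True
    then obtain b where b: "\<And>n. cmod (d n) \<le> b"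
      by (auto simp: bounded_iff)
    show ?thesis
      by (rule summable_comparison_test'[OF summable_mult[OF x, of "b\<^sup>2"]])
        (use b True in \<open>auto simp: norm_mult power_mult_distrib intro!: mult_right_mono power_mono\<close>)
  qed simp
qed

lemma bounded_linear_mult_coords: "bounded_linear (mult_coords d)"
proof (cases "bounded (range d)")
  case True
  then obtain b where b: "\<And>n. cmod (d n) \<le> b"
    by (auto simp: bounded_iff)
  then have b0: "b \<ge> 0"
    using norm_ge_zero order_trans by blast
  show ?thesis
  proof
    show "mult_coords d (x + y) = mult_coords d x + mult_coords d y" for x y
      by transfer (auto simp: distrib_left)
    show "mult_coords d (r *\<^sub>R x) = r *\<^sub>R mult_coords d x" for r x
      by transfer auto
    have "norm (mult_coords d x) \<le> norm x * b" for x
      unfolding mult.commute[of "norm x"]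
      by (rule norm_le_coordwise[OF b0]) (use b True in \<open>auto simp: mult_coords.rep_eq norm_mult
        intro!: mult_right_mono\<close>)
    then show "\<exists>K. \<forall>x. norm (mult_coords d x) \<le> norm x * K"
      by blast
  qed
next
  case False
  then have "mult_coords d x = 0" for x
    by (intro ell2_eqI) (simp add: mult_coords.rep_eq zero_ell2.rep_eq)
  then have "mult_coords d = (\<lambda>_. 0)" by (rule HOL.ext)
  then show ?thesis by simp
qed

definition diag_op :: "(nat \<Rightarrow> complex) \<Rightarrow> ell2 \<Rightarrow>\<^sub>L ell2"
  where "diag_op d = Blinfun (mult_coords d)"

lemma coord_diag_op: "bounded (range d) \<Longrightarrow> coord (diag_op d x) n = d n * coord x n"
  by (simp add: diag_op_def bounded_linear_Blinfun_apply bounded_linear_mult_coords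
      mult_coords.rep_eq)

lemma diag_op_bounded_ops: "bounded (range d) \<Longrightarrow> diag_op d \<in> bounded_ops"
  unfolding bounded_ops_def
  by (auto intro!: ell2_eqI simp: coord_diag_op scaleC.rep_eq)

lemma entry_diag_op: "bounded (range d) \<Longrightarrow> entry (diag_op d) i j = (if i = j then d i else 0)"
  by (simp add: entry_eq_coord coord_diag_op unit_vec.rep_eq)

lemma diag_op_diagonal_ops: "bounded (range d) \<Longrightarrow> diag_op d \<in> diagonal_ops"
  by (simp add: diagonal_ops_def diag_op_bounded_ops entry_diag_op)

lemma diagonal_ops_eq_diag_op:
  assumes "D \<in> diagonal_ops"
  shows "D = diag_op (\<lambda>n. entry D n n)"
  using assms bounded_diagonal_entries[of D]
  by (intro bounded_ops_eq_entryI) (auto simp: diagonal_ops_def diag_op_bounded_ops entry_diag_op)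

lemma coord_diagonal_ops: "D \<in> diagonal_ops \<Longrightarrow> coord (D x) n = entry D n n * coord x n"
  by (subst diagonal_ops_eq_diag_op) (auto simp: coord_diag_op bounded_diagonal_entries)

lemma coord_diag_proj: "coord (diag_proj A x) n = (if n \<in> A then coord x n else 0)"
  by (simp add: diag_proj_apply restrict_coords.rep_eq)

lemma entry_diag_proj: "entry (diag_proj A) i j = (if i = j \<and> i \<in> A then 1 else 0)"
  by (simp add: entry_eq_coord coord_diag_proj unit_vec.rep_eq)

lemma diag_proj_diagonal_ops: "diag_proj A \<in> diagonal_ops"
  by (simp add: diagonal_ops_def bounded_ops_closed entry_diag_proj)

lemma diag_proj_idem: "diag_proj A (diag_proj A x) = diag_proj A x"
  by (rule ell2_eqI) (simp add: coord_diag_proj)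

lemma cinner_diag_proj_left: "cinner (diag_proj A x) y = cinner x (diag_proj A y)"
  by (auto simp: cinner_def coord_diag_proj intro!: arg_cong[where f = suminf])

lemma adj_diag_proj: "adj (diag_proj A) = diag_proj A"
  by (intro adj_eqI bounded_ops_closed cinner_diag_proj_left)

lemma norm_diag_proj_apply_le: "norm (diag_proj A x) \<le> norm x"
  by (simp add: diag_proj_apply norm_restrict_coords)

text \<open>Polarization expresses \<open>4 * cinner (X x) y\<close> by four values of the quadratic
  form. For unit vectors the parallelogram law makes the four squared norms add up to 8, whence the
  factor 2.\<close>

lemma norm_le_numerical_radius:
  assumes X: "X \<in> bounded_ops" and "b \<ge> 0" and w: "\<And>x. cmod (cinner (X x) x) \<le> b * (norm x)\<^sup>2"
  shows "norm X \<le> 2 * b"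
proof (rule norm_blinfun_bound)
  show "2 * b \<ge> 0" using \<open>b \<ge> 0\<close> by simp
  have unit: "cmod (cinner (X x) y) \<le> 2 * b" if "norm x = 1" "norm y = 1" for x y
  proof -
    let ?q = "\<lambda>z. cinner (X z) z"
    have q: "cmod (?q (x + scaleC c y)) \<le> b * (norm (x + scaleC c y))\<^sup>2" for c
      by (rule w)
    have pol: "4 * cinner (X x) y = ?q (x + y) - ?q (x - y) + \<i> * ?q (x + scaleC \<i> y)
        - \<i> * ?q (x - scaleC \<i> y)"
      by (simp add: blinfun.bilinear_simps cinner_linear bounded_ops_scaleC[OF X] algebra_simps)
    have par: "(norm (u + v))\<^sup>2 + (norm (u - v))\<^sup>2 = 2 * (norm u)\<^sup>2 + 2 * (norm v)\<^sup>2" for u v :: ell2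
      by (simp add: power2_norm_eq_inner inner_simps inner_commute)
    have "4 * cmod (cinner (X x) y) = cmod (4 * cinner (X x) y)"
      by (simp add: norm_mult)
    also have "\<dots> \<le> cmod (?q (x + y)) + cmod (?q (x - y)) + cmod (?q (x + scaleC \<i> y))
        + cmod (?q (x - scaleC \<i> y))"
      unfolding pol by (intro order_trans[OF norm_triangle_ineq4] order_trans[OF norm_triangle_ineq] add_mono)
        (simp_all add: norm_mult)
    also have "\<dots> \<le> b * (norm (x + y))\<^sup>2 + b * (norm (x - y))\<^sup>2 + b * (norm (x + scaleC \<i> y))\<^sup>2
        + b * (norm (x - scaleC \<i> y))\<^sup>2"
      by (intro add_mono w)
    also have "\<dots> = b * 8"
      using par[of x y] par[of x "scaleC \<i> y"] that
      by (simp add: norm_scaleC distrib_left[symmetric] add.assoc)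
    finally show ?thesis by simp
  qed
  fix x
  show "norm (X x) \<le> 2 * b * norm x"
  proof (cases "x = 0 \<or> X x = 0")
    case False
    \<comment> \<open>At these unit vectors the sesquilinear form takes the value
      \<open>norm (X x) / norm x\<close>.\<close>
    define u v where "u = x /\<^sub>R norm x" and "v = X x /\<^sub>R norm (X x)"
    have "norm u = 1" "norm v = 1"
      using False by (simp_all add: u_def v_def)
    then have "cmod (cinner (X u) v) \<le> 2 * b"
      by (rule unit)
    moreover have "cinner (X u) v = of_real (norm (X x) / norm x)"
      using False unfolding u_def v_def
      by (simp add: blinfun.scaleR_right scaleR_eq_scaleC bounded_ops_scaleC[OF X]
          cinner_linear cinner_self divide_simps power2_eq_square)
    ultimately show ?thesis
      using False by (simp add: norm_divide divide_simps del: of_real_divide)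
  qed (use \<open>b \<ge> 0\<close> in auto)
qed


section \<open>States\<close>

lemma state_add: "state \<phi> \<Longrightarrow> X \<in> bounded_ops \<Longrightarrow> Y \<in> bounded_ops \<Longrightarrow> \<phi> (X + Y) = \<phi> X + \<phi> Y"
  and state_scaleC: "state \<phi> \<Longrightarrow> X \<in> bounded_ops \<Longrightarrow> \<phi> (scaleC_op c X) = c * \<phi> X"
  and state_pos: "state \<phi> \<Longrightarrow> X \<in> bounded_ops \<Longrightarrow> positive_op X \<Longrightarrow> \<phi> X \<in> \<real>\<^sub>\<ge>\<^sub>0"
  and state_id: "state \<phi> \<Longrightarrow> \<phi> id_blinfun = 1"
  by (simp_all add: state_def)

lemma state_scaleR: "state \<phi> \<Longrightarrow> X \<in> bounded_ops \<Longrightarrow> \<phi> (r *\<^sub>R X) = of_real r * \<phi> X"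
  by (simp add: scaleR_eq_scaleC_op state_scaleC)

lemma state_diff:
  assumes "state \<phi>" and "X \<in> bounded_ops" and "Y \<in> bounded_ops"
  shows "\<phi> (X - Y) = \<phi> X - \<phi> Y"
  using state_add[OF assms(1), of "X - Y" Y] assms by (simp add: bounded_ops_closed)

lemma state_mono:
  assumes "state \<phi>" and "X \<in> bounded_ops" and "Y \<in> bounded_ops" and "X \<preceq> Y"
  shows "Re (\<phi> X) \<le> Re (\<phi> Y)"
  using state_pos[OF assms(1) bounded_ops_closed(3)[OF assms(3,2)]] state_diff[OF assms(1,3,2)] assms(4)
  by (auto simp: op_le_def nonneg_Reals_def complex_eq_iff)

text \<open>The hypothesis is positivity of a state at \<open>adj Z o\<^sub>L Z\<close> with
  \<open>Z = B + scaleC_op c C\<close>, expanded in \<open>c\<close>. The values 1 and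
  \<open>\<i>\<close> of \<open>c\<close> give conjugate symmetry, and negative multiples of
  \<open>cnj b\<close> give the inequality.\<close>

lemma sesquilinear_cauchy_schwarz:
  fixes a b b' d :: complex
  assumes nn: "\<And>c. a + c * b + cnj c * b' + of_real ((cmod c)\<^sup>2) * d \<in> \<real>\<^sub>\<ge>\<^sub>0"
    and ad: "a \<in> \<real>\<^sub>\<ge>\<^sub>0" "d \<in> \<real>\<^sub>\<ge>\<^sub>0"
  shows "b' = cnj b" and "(cmod b)\<^sup>2 \<le> Re a * Re d"
proof -
  have im: "Im a = 0" "Im d = 0" and re: "Re a \<ge> 0" "Re d \<ge> 0"
    using ad by (auto simp: complex_nonneg_Reals_iff)
  show b': "b' = cnj b"
    using nn[of 1] nn[of \<i>] im by (auto simp: complex_nonneg_Reals_iff complex_eq_iff)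
  have quad: "0 \<le> Re a - 2 * s * (cmod b)\<^sup>2 + s\<^sup>2 * (cmod b)\<^sup>2 * Re d" for s :: real
  proof -
    have "a + c * b + cnj c * b' + of_real ((cmod c)\<^sup>2) * d
        = of_real (Re a - 2 * s * (cmod b)\<^sup>2 + s\<^sup>2 * (cmod b)\<^sup>2 * Re d)"
      if "c = - of_real s * cnj b" for c
      using that im unfolding b' cmod_power2
      by (simp add: complex_eq_iff algebra_simps power2_eq_square)
    from nn[of "- of_real s * cnj b", unfolded this[OF refl]] show ?thesis
      by (simp only: nonneg_Reals_of_real_iff)
  qed
  show "(cmod b)\<^sup>2 \<le> Re a * Re d"
  \<comment> \<open>The quadratic in \<open>s\<close> is minimised at \<open>1 / Re d\<close>. If
    \<open>Re d\<close> vanishes it is affine, and a large \<open>s\<close> makes it negative unless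
    \<open>b\<close> is zero.\<close>
  proof (cases "Re d = 0")
    case True
    have "(cmod b)\<^sup>2 = 0"
    proof (rule ccontr)
      assume "(cmod b)\<^sup>2 \<noteq> 0"
      then have "0 \<le> Re a - 2 * (Re a + 1)"
        using quad[of "(Re a + 1) / (cmod b)\<^sup>2"] True by simp
      then show False using re by simp
    qed
    then show ?thesis using True by simp
  next
    case False
    then show ?thesis
      using quad[of "1 / Re d"] re by (simp add: field_simps power2_eq_square)
  qed
qed

lemma positive_op_adj_comp: "X \<in> bounded_ops \<Longrightarrow> positive_op (adj X o\<^sub>L X)"
  by (simp add: positive_op_def cinner_adj_left cinner_self_nonneg_Reals)

lemma state_cauchy_schwarz:
  assumes \<phi>: "state \<phi>" and B: "B \<in> bounded_ops" and C: "C \<in> bounded_ops"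
  shows "\<phi> (adj C o\<^sub>L B) = cnj (\<phi> (adj B o\<^sub>L C))"
    and "(cmod (\<phi> (adj B o\<^sub>L C)))\<^sup>2 \<le> Re (\<phi> (adj B o\<^sub>L B)) * Re (\<phi> (adj C o\<^sub>L C))"
proof -
  note bo = bounded_ops_closed B C
  have form: "\<phi> (adj B o\<^sub>L B) + c * \<phi> (adj B o\<^sub>L C) + cnj c * \<phi> (adj C o\<^sub>L B)
      + of_real ((cmod c)\<^sup>2) * \<phi> (adj C o\<^sub>L C) \<in> \<real>\<^sub>\<ge>\<^sub>0" for c
  proof -
    let ?Z = "B + scaleC_op c C"
    have "adj ?Z o\<^sub>L ?Z = (adj B o\<^sub>L B) + scaleC_op c (adj B o\<^sub>L C) + (scaleC_op (cnj c) (adj C o\<^sub>L B)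
        + scaleC_op (of_real ((cmod c)\<^sup>2)) (adj C o\<^sub>L C))"
      by (rule blinfun_eqI) (simp add: adj_simps adj_scaleC_op bo blinfun.bilinear_simps
          scaleC_op_apply bounded_ops_scaleC
          scaleC_add_right scaleC_scaleC complex_norm_square mult.commute del: of_real_power)
    then have "\<phi> (adj ?Z o\<^sub>L ?Z) = \<phi> (adj B o\<^sub>L B) + c * \<phi> (adj B o\<^sub>L C) + cnj c * \<phi> (adj C o\<^sub>L B)
        + of_real ((cmod c)\<^sup>2) * \<phi> (adj C o\<^sub>L C)"
      by (simp add: state_add[OF \<phi>] state_scaleC[OF \<phi>] bo del: of_real_power)
    moreover have "\<phi> (adj ?Z o\<^sub>L ?Z) \<in> \<real>\<^sub>\<ge>\<^sub>0"
      by (intro state_pos[OF \<phi>] positive_op_adj_comp bo)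
    ultimately show ?thesis by simp
  qed
  have pos: "\<phi> (adj B o\<^sub>L B) \<in> \<real>\<^sub>\<ge>\<^sub>0" "\<phi> (adj C o\<^sub>L C) \<in> \<real>\<^sub>\<ge>\<^sub>0"
    by (intro state_pos[OF \<phi>] positive_op_adj_comp bo)+
  show "\<phi> (adj C o\<^sub>L B) = cnj (\<phi> (adj B o\<^sub>L C))"
    and "(cmod (\<phi> (adj B o\<^sub>L C)))\<^sup>2 \<le> Re (\<phi> (adj B o\<^sub>L B)) * Re (\<phi> (adj C o\<^sub>L C))"
    using sesquilinear_cauchy_schwarz[OF form pos] by auto
qed

lemma state_adj: "state \<phi> \<Longrightarrow> X \<in> bounded_ops \<Longrightarrow> \<phi> (adj X) = cnj (\<phi> X)"
  using state_cauchy_schwarz(1)[of \<phi> id_blinfun X]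
  by (simp add: bounded_ops_closed)

lemma state_kadison: "state \<phi> \<Longrightarrow> X \<in> bounded_ops \<Longrightarrow> (cmod (\<phi> X))\<^sup>2 \<le> Re (\<phi> (adj X o\<^sub>L X))"
  using state_cauchy_schwarz(2)[of \<phi> id_blinfun X]
  by (simp add: bounded_ops_closed state_id)

text \<open>Kadison's inequality reduces the bound to \<open>adj X o\<^sub>L X\<close>, which lies
  below the square of \<open>norm X\<close> times the identity.\<close>

lemma state_norm_le:
  assumes \<phi>: "state \<phi>" and X: "X \<in> bounded_ops"
  shows "cmod (\<phi> X) \<le> norm X"
proof -
  let ?N = "((norm X)\<^sup>2) *\<^sub>R (id_blinfun :: ell2 \<Rightarrow>\<^sub>L ell2)"
  have N: "?N \<in> bounded_ops"
    by (intro bounded_ops_scaleR bounded_ops_closed)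
  have "adj X o\<^sub>L X \<preceq> ?N"
    unfolding op_le_def positive_op_def
  proof
    fix x
    have "cinner ((?N - (adj X o\<^sub>L X)) x) x = of_real ((norm X * norm x)\<^sup>2 - (norm (X x))\<^sup>2)"
      by (simp add: blinfun.bilinear_simps cinner_linear cinner_adj_left[OF X] cinner_self scaleR_eq_scaleC
          power_mult_distrib)
    moreover have "(norm (X x))\<^sup>2 \<le> (norm X * norm x)\<^sup>2"
      by (intro power_mono norm_blinfun norm_ge_zero)
    ultimately show "cinner ((?N - (adj X o\<^sub>L X)) x) x \<in> \<real>\<^sub>\<ge>\<^sub>0"
      by (simp only: nonneg_Reals_of_real_iff diff_ge_0_iff_ge)
  qed
  then have "Re (\<phi> (adj X o\<^sub>L X)) \<le> Re (\<phi> ?N)"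
    by (intro state_mono[OF \<phi>] N bounded_ops_closed X)
  also have "\<dots> = (norm X)\<^sup>2"
    by (simp add: state_scaleR[OF \<phi>] bounded_ops_closed state_id[OF \<phi>] del: of_real_power)
  finally show ?thesis
    using order_trans[OF state_kadison[OF \<phi> X]] power2_le_imp_le[OF _ norm_ge_zero] by blast
qed

text \<open>The complementary projection \<open>Q\<close> has state value 0, so Cauchy-Schwarz
  annihilates every product with \<open>Q\<close> on the left or on the right; only the corner cut
  out by \<open>diag_proj A\<close> contributes.\<close>

lemma state_compression:
  assumes \<phi>: "state \<phi>" and X: "X \<in> bounded_ops" and A: "\<phi> (diag_proj A) = 1"
  shows "\<phi> (diag_proj A o\<^sub>L X o\<^sub>L diag_proj A) = \<phi> X"
proof -
  let ?P = "diag_proj A"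
  define Q where "Q = id_blinfun - ?P"
  have Q: "Q \<in> bounded_ops" and P: "?P \<in> bounded_ops"
    by (simp_all add: Q_def bounded_ops_closed)
  have adjQ: "adj Q = Q"
    unfolding Q_def by (simp add: adj_simps adj_diag_proj bounded_ops_closed)
  have "adj Q o\<^sub>L Q = Q"
    unfolding adjQ by (rule blinfun_eqI) (simp add: Q_def blinfun.bilinear_simps diag_proj_idem)
  moreover have "\<phi> Q = 0"
    by (simp add: Q_def state_diff[OF \<phi>] bounded_ops_closed A state_id[OF \<phi>])
  ultimately have left: "\<phi> (Q o\<^sub>L Y) = 0" if "Y \<in> bounded_ops" for Y
    using state_cauchy_schwarz(2)[OF \<phi> Q that] by (simp add: adjQ)
  have right: "\<phi> (X o\<^sub>L Q) = 0"
  proof -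
    have "X o\<^sub>L Q = adj (Q o\<^sub>L adj X)"
      using X Q by (simp add: adj_simps adj_adj bounded_ops_closed adjQ)
    then show ?thesis
      using X Q left[of "adj X"] by (simp add: state_adj[OF \<phi>] bounded_ops_closed)
  qed
  have "X = (?P o\<^sub>L X o\<^sub>L ?P) + ((Q o\<^sub>L (X o\<^sub>L ?P)) + (X o\<^sub>L Q))"
    by (rule blinfun_eqI) (simp add: Q_def blinfun.bilinear_simps)
  then have "\<phi> X = \<phi> ((?P o\<^sub>L X o\<^sub>L ?P) + ((Q o\<^sub>L (X o\<^sub>L ?P)) + (X o\<^sub>L Q)))"
    by simp
  also have "\<dots> = \<phi> (?P o\<^sub>L X o\<^sub>L ?P)"
    using X P Q by (simp add: state_add[OF \<phi>] bounded_ops_closed left right)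
  finally show ?thesis ..
qed

section \<open>Limits of vector states extending point evaluations\<close>

lemma eval_state_tendsto: "((\<lambda>n. entry X n n) \<longlongrightarrow> eval_state \<omega> X) (ultrafilter \<omega>)"
  unfolding eval_state_def by (rule beta_extension_bounded(3)[OF bounded_diagonal_entries])

lemma eval_state_eqI: "((\<lambda>n. entry X n n) \<longlongrightarrow> l) (ultrafilter \<omega>) \<Longrightarrow> eval_state \<omega> X = l"
  by (rule tendsto_unique[OF ultrafilter_not_bot eval_state_tendsto])

lemma state_extension_diag_proj:
  assumes "state_extension \<omega> \<phi>" and "\<forall>\<^sub>F n in ultrafilter \<omega>. n \<in> A"
  shows "\<phi> (diag_proj A) = 1"
proof -
  have "eval_state \<omega> (diag_proj A) = 1"
    by (rule eval_state_eqI, rule tendsto_eventually)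
      (use assms(2) in \<open>auto simp: entry_diag_proj elim: eventually_mono\<close>)
  then show ?thesis
    using assms(1) diag_proj_diagonal_ops by (simp add: state_extension_def)
qed

text \<open>On unit vectors the values \<open>cinner (X x) x\<close> are bounded by
  \<open>norm X\<close>, so they converge along \<open>U\<close>. Linearity passes to the limit, and
  so does positivity since the nonnegative reals are closed.\<close>

lemma state_of_limit:
  assumes U: "ultra U" and norm: "\<forall>\<^sub>F x in U. norm x = 1"
  obtains \<phi> where "state \<phi>" and "\<And>X. ((\<lambda>x. cinner (blinfun_apply X x) x) \<longlongrightarrow> \<phi> X) U"
proof -
  have nb: "U \<noteq> bot" using U by (simp add: ultra_def)
  have "\<exists>l. ((\<lambda>x. cinner (blinfun_apply X x) x) \<longlongrightarrow> l) U" for X :: "ell2 \<Rightarrow>\<^sub>L ell2"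
  proof (rule ultra_limit_exists[OF U])
    show "\<forall>\<^sub>F x in U. cmod (cinner (X x) x) \<le> norm X"
      using norm
    proof eventually_elim
      case (elim x)
      then show ?case
        using cinner_cauchy_schwarz[of "X x" x] norm_blinfun[of X x] by simp
    qed
  qed
  then obtain \<phi> where \<phi>: "\<And>X. ((\<lambda>x. cinner (blinfun_apply X x) x) \<longlongrightarrow> \<phi> X) U"
    by metis
  have eqI: "\<phi> X = l" if "((\<lambda>x. cinner (blinfun_apply X x) x) \<longlongrightarrow> l) U" for X l
    using tendsto_unique[OF nb \<phi> that] .
  have "state \<phi>"
    unfolding state_def
  proof (intro conjI ballI allI impI)
    fix X Y :: "ell2 \<Rightarrow>\<^sub>L ell2"
    show "\<phi> (X + Y) = \<phi> X + \<phi> Y"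
      by (rule eqI) (simp add: blinfun.bilinear_simps cinner_linear tendsto_add \<phi>)
    show "\<phi> (scaleC_op c X) = c * \<phi> X" for c
      by (rule eqI) (simp add: scaleC_op_apply cinner_linear tendsto_mult \<phi>)
    assume "positive_op X"
    then show "\<phi> X \<in> \<real>\<^sub>\<ge>\<^sub>0"
      by (intro Lim_in_closed_set[OF closed_nonneg_Reals_complex _ nb \<phi>]) (simp add: positive_op_def)
  next
    show "\<phi> id_blinfun = 1"
      by (rule eqI, rule tendsto_eventually)
        (use norm in \<open>auto simp: cinner_self elim: eventually_mono\<close>)
  qed
  then show ?thesis
    using \<phi> by (rule that)
qed

lemma state_extension_of_limit:
  assumes U: "ultra U" and norm: "\<forall>\<^sub>F x in U. norm x = 1"
    and supp: "\<And>A. \<forall>\<^sub>F n in ultrafilter \<omega>. n \<in> A \<Longrightarrow> \<forall>\<^sub>F x in U. diag_proj A x = x"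
  obtains \<phi> where "state_extension \<omega> \<phi>"
    and "\<And>X. ((\<lambda>x. cinner (blinfun_apply X x) x) \<longlongrightarrow> \<phi> X) U"
proof -
  obtain \<phi> where \<phi>: "state \<phi>" "\<And>X. ((\<lambda>x. cinner (blinfun_apply X x) x) \<longlongrightarrow> \<phi> X) U"
    using state_of_limit[OF U norm] by blast
  have "\<phi> D = eval_state \<omega> D" if D: "D \<in> diagonal_ops" for D
  proof -
    let ?l = "eval_state \<omega> D"
    have "((\<lambda>x. cinner (D x) x) \<longlongrightarrow> ?l) U"
    proof (rule tendstoI)
      fix e :: real assume e: "e > 0"
      \<comment> \<open>On \<open>A\<close> the diagonal differs from its limit by less than
        \<open>e / 2\<close>, so for \<open>x\<close> supported there \<open>D x\<close> is within
        \<open>e / 2 * norm x\<close> of the scalar multiple of \<open>x\<close>.\<close>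
      define A where "A = {n. dist (entry D n n) ?l < e / 2}"
      have "\<forall>\<^sub>F n in ultrafilter \<omega>. n \<in> A"
        unfolding A_def mem_Collect_eq using e by (intro tendstoD[OF eval_state_tendsto]) simp
      from supp[OF this] norm show "\<forall>\<^sub>F x in U. dist (cinner (D x) x) ?l < e"
      proof eventually_elim
        case (elim x)
        have zero: "coord x n = 0" if "n \<notin> A" for n
          using arg_cong[OF elim(1), of "\<lambda>y. coord y n"] that by (simp add: coord_diag_proj)
        have "norm (D x - scaleC ?l x) \<le> e / 2 * norm x"
        proof (rule norm_le_coordwise)
          show "0 \<le> e / 2" using e by simp
          fix n
          have "coord (D x - scaleC ?l x) n = (entry D n n - ?l) * coord x n"
            by (simp add: minus_ell2.rep_eq scaleC.rep_eq coord_diagonal_ops[OF D] algebra_simps)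
          then show "cmod (coord (D x - scaleC ?l x) n) \<le> e / 2 * cmod (coord x n)"
            using mult_right_mono[of "cmod (entry D n n - ?l)" "e / 2" "cmod (coord x n)"]
            by (cases "n \<in> A") (simp_all add: norm_mult A_def dist_norm zero)
        qed
        moreover have "cinner (D x) x - ?l = cinner (D x - scaleC ?l x) x"
          using elim(2) by (simp add: cinner_linear cinner_self)
        ultimately have "dist (cinner (D x) x) ?l \<le> e / 2"
          using cinner_cauchy_schwarz[of "D x - scaleC ?l x" x] elim(2) by (simp add: dist_norm)
        then show ?case using e by simp
      qed
    qed
    from tendsto_unique[OF _ \<phi>(2) this] U show ?thesis
      by (simp add: ultra_def)
  qed
  then show ?thesis
    using \<phi> by (intro that[of \<phi>]) (auto simp: state_extension_def)
qed

text \<open>The vector states at the basis vectors, taken to the limit along \<omega>, see only the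
  diagonal of an operator. This gives existence of an extension, and one that vanishes at operators
  with zero diagonal.\<close>

lemma eval_state_extension: "\<exists>\<phi>. state_extension \<omega> \<phi> \<and> (\<forall>X. \<phi> X = eval_state \<omega> X)"
proof -
  let ?U = "filtermap unit_vec (ultrafilter \<omega>)"
  have "\<forall>\<^sub>F x in ?U. diag_proj A x = x" if "\<forall>\<^sub>F n in ultrafilter \<omega>. n \<in> A" for A
    using that unfolding eventually_filtermap
    by eventually_elim (auto intro!: ell2_eqI simp: coord_diag_proj unit_vec.rep_eq)
  moreover have "\<forall>\<^sub>F x in ?U. norm x = 1"
    by (simp add: eventually_filtermap)
  ultimately obtain \<phi> where \<phi>: "state_extension \<omega> \<phi>"
    "\<And>X. ((\<lambda>x. cinner (blinfun_apply X x) x) \<longlongrightarrow> \<phi> X) ?U"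
    using state_extension_of_limit[OF ultra_filtermap[OF ultra_ultrafilter]] by blast
  have "eval_state \<omega> X = \<phi> X" for X
    using \<phi>(2)[of X] by (intro eval_state_eqI) (simp add: filterlim_filtermap entry_def)
  then show ?thesis
    using \<phi>(1) by (intro exI[of _ \<phi>]) simp
qed


section \<open>Pavings\<close>

lemma diag_proj_mono:
  assumes "diag_proj A x = x" and "A \<subseteq> B"
  shows "diag_proj B x = x"
proof (rule ell2_eqI)
  show "coord (diag_proj B x) n = coord x n" for n
    using arg_cong[OF assms(1), of "\<lambda>y. coord y n"] assms(2)
    by (auto simp: coord_diag_proj split: if_splits)
qed

text \<open>If every set in \<omega> carried a large value of the form, a limit of such vector
  states would be an extension of modulus at least \<open>e\<close> at \<open>T\<close>, different
  from the one that reads off the zero diagonal.\<close>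

lemma kadison_singer_small_set:
  assumes KS: "kadison_singer" and T: "T \<in> bounded_ops" and diag: "\<And>n. entry T n n = 0"
    and e: "e > 0"
  shows "\<exists>A. (\<forall>\<^sub>F n in ultrafilter \<omega>. n \<in> A) \<and>
    (\<forall>x. diag_proj A x = x \<longrightarrow> cmod (cinner (T x) x) \<le> e * (norm x)\<^sup>2)"
proof (rule ccontr)
  assume none: "\<not> ?thesis"
  define S where "S A = {x. norm x = 1 \<and> diag_proj A x = x \<and> e \<le> cmod (cinner (T x) x)}" for A
  let ?W = "{A. \<forall>\<^sub>F n in ultrafilter \<omega>. n \<in> A}"
  have nonempty: "S A \<noteq> {}" if A: "A \<in> ?W" for A
  proof -
    obtain x where x: "diag_proj A x = x" "e * (norm x)\<^sup>2 < cmod (cinner (T x) x)"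
      using none A by (auto simp: not_le)
    then have "norm x > 0" by auto
    define u where "u = scaleC (of_real (1 / norm x)) x"
    have "norm u = 1"
      using \<open>norm x > 0\<close> by (simp add: u_def norm_scaleC norm_divide)
    moreover have "diag_proj A u = u"
      by (simp add: u_def bounded_ops_scaleC[OF bounded_ops_closed(8)] x(1))
    moreover have "cmod (cinner (T u) u) = cmod (cinner (T x) x) / (norm x)\<^sup>2"
      by (simp add: u_def bounded_ops_scaleC[OF T] cinner_linear norm_mult norm_divide power2_eq_square)
    then have "e \<le> cmod (cinner (T u) u)"
      using x(2) \<open>norm x > 0\<close> by (simp add: pos_le_divide_eq)
    ultimately show ?thesis unfolding S_def by blast
  qed
  define F where "F = (INF A\<in>?W. principal (S A))"
  have "F \<noteq> bot"
    unfolding F_def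
  proof (rule INF_filter_not_bot)
    \<comment> \<open>\<omega> is closed under finite intersections and \<open>S\<close> is
      monotone, so a witness for the intersection serves all members of the family.\<close>
    fix \<F> assume sub: "\<F> \<subseteq> ?W" and fin: "finite \<F>"
    have "\<forall>\<^sub>F n in ultrafilter \<omega>. \<forall>A\<in>\<F>. n \<in> A"
      using sub fin by (intro eventually_ball_finite) auto
    then have "\<Inter>\<F> \<in> ?W"
      by simp
    then obtain x where "x \<in> S (\<Inter>\<F>)"
      using nonempty by blast
    moreover have "S (\<Inter>\<F>) \<subseteq> S A" if "A \<in> \<F>" for A
      using that diag_proj_mono[of "\<Inter>\<F>" _ A] by (auto simp: S_def)
    ultimately have "x \<in> (\<Inter>A\<in>\<F>. S A)"
      by blast
    then show "(INF A\<in>\<F>. principal (S A)) \<noteq> bot"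
      unfolding INF_principal_finite[OF fin] principal_eq_bot_iff by blast
  qed
  then obtain U where U: "U \<le> F" "ultra U"
    using ultrafilter_exists by blast
  have in_S: "\<forall>\<^sub>F x in U. x \<in> S A" if "\<forall>\<^sub>F n in ultrafilter \<omega>. n \<in> A" for A
    using that unfolding F_def
    by (intro filter_leD[OF U(1)[unfolded F_def]] eventually_INF1[of A]) (auto simp: eventually_principal)
  have norm: "\<forall>\<^sub>F x in U. norm x = 1"
    using in_S[of UNIV] by (auto simp: S_def elim: eventually_mono)
  have supp: "\<forall>\<^sub>F x in U. diag_proj A x = x" if "\<forall>\<^sub>F n in ultrafilter \<omega>. n \<in> A" for A
    using in_S[OF that] by (auto simp: S_def elim: eventually_mono)
  obtain \<phi> where \<phi>: "state_extension \<omega> \<phi>"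
    "\<And>X. ((\<lambda>x. cinner (blinfun_apply X x) x) \<longlongrightarrow> \<phi> X) U"
    using state_extension_of_limit[OF U(2) norm supp] by blast
  have "closed {z. e \<le> cmod z}"
    by (intro closed_Collect_le continuous_intros)
  moreover have "\<forall>\<^sub>F x in U. cinner (T x) x \<in> {z. e \<le> cmod z}"
    using in_S[of UNIV] by (auto simp: S_def elim: eventually_mono)
  ultimately have "\<phi> T \<in> {z. e \<le> cmod z}"
    using U(2) by (intro Lim_in_closed_set[OF _ _ _ \<phi>(2)]) (auto simp: ultra_def)
  moreover obtain \<psi> where \<psi>: "state_extension \<omega> \<psi>" "\<psi> T = eval_state \<omega> T"
    using eval_state_extension by blast
  moreover have "eval_state \<omega> T = 0"
    by (rule eval_state_eqI) (simp add: diag)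
  moreover have "\<phi> T = \<psi> T"
    using KS \<phi>(1) \<psi>(1) T unfolding kadison_singer_def by metis
  ultimately show False using e by simp
qed

text \<open>Enumerating the cover and removing from each set its predecessors makes it disjoint;
  empty pieces are allowed in a paving.\<close>

lemma paving_of_finite_cover:
  assumes "finite \<F>" and "\<Union>\<F> = UNIV"
  obtains r A where "paving r A" and "\<And>i. i \<in> {1..r} \<Longrightarrow> \<exists>B\<in>\<F>. A i \<subseteq> B"
proof -
  define r where "r = card \<F>"
  obtain h where h: "bij_betw h {1..r} \<F>"
    using ex_bij_betw_nat_finite_1[OF assms(1)] unfolding r_def by blast
  define A where "A i = h i - (\<Union>j\<in>{1..<i}. h j)" for i
  have "paving r A"
    unfolding paving_def
  proof
    show "disjoint_family_on A {1..r}"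
      unfolding disjoint_family_on_def
    proof (intro ballI impI)
      fix i j assume "i \<in> {1..r}" "j \<in> {1..r}" "i \<noteq> j"
      then have "i \<in> {1..<j} \<or> j \<in> {1..<i}" by auto
      then show "A i \<inter> A j = {}" unfolding A_def by blast
    qed
    have "n \<in> (\<Union>i\<in>{1..r}. A i)" for n
    proof -
      have "\<exists>i. i \<in> {1..r} \<and> n \<in> h i"
        using assms(2) bij_betw_imp_surj_on[OF h] by blast
      then obtain i where i: "i \<in> {1..r}" "n \<in> h i"
        and least: "\<And>j. j < i \<Longrightarrow> \<not> (j \<in> {1..r} \<and> n \<in> h j)"
        using exists_least_iff[of "\<lambda>i. i \<in> {1..r} \<and> n \<in> h i"] by blast
      have "n \<in> A i"
        using i least by (auto simp: A_def)
      then show ?thesis using i(1) by blast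
    qed
    then show "(\<Union>i\<in>{1..r}. A i) = UNIV" by blast
  qed
  moreover have "\<exists>B\<in>\<F>. A i \<subseteq> B" if "i \<in> {1..r}" for i
    using bij_betw_apply[OF h that] unfolding A_def by blast
  ultimately show ?thesis by (rule that)
qed

lemma kadison_singer_imp_upper_norm_paving:
  assumes KS: "kadison_singer"
  shows "upper_norm_paving"
  unfolding upper_norm_paving_def
proof (intro ballI allI impI)
  fix T and \<epsilon> :: real
  assume "T \<in> strictly_upper_ops" and \<epsilon>: "\<epsilon> > 0"
  then have T: "T \<in> bounded_ops" "\<And>n. entry T n n = 0"
    by (auto simp: strictly_upper_ops_def)
  \<comment> \<open>A quarter of \<epsilon>: the norm is at most twice the numerical radius, and the
    final inequality has to be strict.\<close>
  define small where "small A \<longleftrightarrow>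
    (\<forall>x. diag_proj A x = x \<longrightarrow> cmod (cinner (T x) x) \<le> \<epsilon> / 4 * (norm x)\<^sup>2)" for A
  have "\<exists>A\<in>Collect small. \<forall>\<^sub>F n in ultrafilter \<omega>. n \<in> A" for \<omega>
    using kadison_singer_small_set[OF KS T, of "\<epsilon> / 4" \<omega>] \<epsilon> unfolding small_def by auto
  then obtain \<F> where \<F>: "finite \<F>" "\<F> \<subseteq> Collect small" "\<Union>\<F> = UNIV"
    using betaN_compact_cover by metis
  obtain r A where A: "paving r A" "\<And>i. i \<in> {1..r} \<Longrightarrow> \<exists>B\<in>\<F>. A i \<subseteq> B"
    using paving_of_finite_cover[OF \<F>(1,3)] by blast
  have "norm (diag_proj (A i) o\<^sub>L T o\<^sub>L diag_proj (A i)) < \<epsilon>" if i: "i \<in> {1..r}" for i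
  proof -
    let ?P = "diag_proj (A i)"
    obtain B where B: "B \<in> \<F>" "A i \<subseteq> B"
      using A(2)[OF i] by blast
    have "norm (?P o\<^sub>L T o\<^sub>L ?P) \<le> 2 * (\<epsilon> / 4)"
    proof (rule norm_le_numerical_radius)
      show "?P o\<^sub>L T o\<^sub>L ?P \<in> bounded_ops"
        by (intro bounded_ops_closed T)
      show "0 \<le> \<epsilon> / 4" using \<epsilon> by simp
      fix x
      have "diag_proj B (?P x) = ?P x"
        by (rule diag_proj_mono[OF diag_proj_idem B(2)])
      then have "cmod (cinner (T (?P x)) (?P x)) \<le> \<epsilon> / 4 * (norm (?P x))\<^sup>2"
        using B(1) \<F>(2) unfolding small_def by blast
      also have "\<dots> \<le> \<epsilon> / 4 * (norm x)\<^sup>2"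
        using \<epsilon> by (intro mult_left_mono power_mono norm_diag_proj_apply_le) auto
      finally show "cmod (cinner ((?P o\<^sub>L T o\<^sub>L ?P) x) x) \<le> \<epsilon> / 4 * (norm x)\<^sup>2"
        by (simp add: cinner_diag_proj_left)
    qed
    then show ?thesis using \<epsilon> by simp
  qed
  then show "\<exists>r A. paving r A \<and> (\<forall>i\<in>{1..r}. norm (diag_proj (A i) o\<^sub>L T o\<^sub>L diag_proj (A i)) < \<epsilon>)"
    using A(1) by blast
qed

text \<open>With \<open>y = diag_proj A x\<close>, the form of the compressed
  \<open>T + adj T\<close> at \<open>x\<close> is twice the real part of
  \<open>cinner (T y) y\<close>, while that of the scaled projection is \<epsilon> times the squared
  norm of \<open>y\<close>.\<close>

lemma compression_order_bound:
  assumes T: "T \<in> bounded_ops" and le: "norm (diag_proj A o\<^sub>L T o\<^sub>L diag_proj A) \<le> \<epsilon> / 2"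
  shows "- (\<epsilon> *\<^sub>R diag_proj A) \<preceq> diag_proj A o\<^sub>L (T + adj T) o\<^sub>L diag_proj A"
    and "diag_proj A o\<^sub>L (T + adj T) o\<^sub>L diag_proj A \<preceq> \<epsilon> *\<^sub>R diag_proj A"
proof -
  let ?P = "diag_proj A"
  have form: "cinner ((?P o\<^sub>L (T + adj T) o\<^sub>L ?P) x) x = of_real (2 * Re (cinner (T (?P x)) (?P x)))" for x
  proof -
    have "cinner ((?P o\<^sub>L (T + adj T) o\<^sub>L ?P) x) x
        = cinner (T (?P x)) (?P x) + cnj (cinner (T (?P x)) (?P x))"
      by (simp add: cinner_diag_proj_left blinfun.bilinear_simps cinner_linear cinner_adj_left[OF T]
          cinner_commute[symmetric])
    then show ?thesis by (simp add: complex_add_cnj)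
  qed
  have proj: "cinner ((\<epsilon> *\<^sub>R ?P) x) x = of_real (\<epsilon> * (norm (?P x))\<^sup>2)" for x
  proof -
    have "cinner (?P x) x = cinner (?P x) (?P x)"
      by (metis cinner_diag_proj_left diag_proj_idem)
    then show ?thesis
      by (simp add: scaleR_blinfun.rep_eq scaleR_eq_scaleC cinner_linear cinner_self)
  qed
  have bound: "\<bar>2 * Re (cinner (T (?P x)) (?P x))\<bar> \<le> \<epsilon> * (norm (?P x))\<^sup>2" for x
  proof -
    let ?y = "?P x"
    \<comment> \<open>Since \<open>?y\<close> lies in the range of the projection, \<open>T\<close>
      may be replaced by its compression, whose norm is controlled.\<close>
    have "cinner (T ?y) ?y = cinner ((?P o\<^sub>L T o\<^sub>L ?P) ?y) ?y"
      by (simp add: cinner_diag_proj_left diag_proj_idem)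
    then have "cmod (cinner (T ?y) ?y) \<le> norm ((?P o\<^sub>L T o\<^sub>L ?P) ?y) * norm ?y"
      using cinner_cauchy_schwarz by metis
    also have "\<dots> \<le> (\<epsilon> / 2 * norm ?y) * norm ?y"
      by (intro mult_right_mono order_trans[OF norm_blinfun] mult_right_mono le norm_ge_zero)
    finally show ?thesis
      using abs_Re_le_cmod[of "cinner (T ?y) ?y"] by (simp add: power2_eq_square abs_mult)
  qed
  show "- (\<epsilon> *\<^sub>R ?P) \<preceq> ?P o\<^sub>L (T + adj T) o\<^sub>L ?P"
    unfolding op_le_def positive_op_def
  proof
    fix x
    have "cinner (((?P o\<^sub>L (T + adj T) o\<^sub>L ?P) - (- (\<epsilon> *\<^sub>R ?P))) x) x
        = of_real (2 * Re (cinner (T (?P x)) (?P x)) + \<epsilon> * (norm (?P x))\<^sup>2)"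
      by (simp only: minus_blinfun.rep_eq uminus_blinfun.rep_eq plus_blinfun.rep_eq cinner_linear
          form proj of_real_add diff_minus_eq_add)
    then show "cinner (((?P o\<^sub>L (T + adj T) o\<^sub>L ?P) - (- (\<epsilon> *\<^sub>R ?P))) x) x \<in> \<real>\<^sub>\<ge>\<^sub>0"
      using bound[of x] by (simp only: nonneg_Reals_of_real_iff)
  qed
  show "?P o\<^sub>L (T + adj T) o\<^sub>L ?P \<preceq> \<epsilon> *\<^sub>R ?P"
    unfolding op_le_def positive_op_def
  proof
    fix x
    have "cinner ((\<epsilon> *\<^sub>R ?P - (?P o\<^sub>L (T + adj T) o\<^sub>L ?P)) x) x
        = of_real (\<epsilon> * (norm (?P x))\<^sup>2 - 2 * Re (cinner (T (?P x)) (?P x)))"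
      by (simp only: minus_blinfun.rep_eq cinner_linear form proj of_real_diff)
    then show "cinner ((\<epsilon> *\<^sub>R ?P - (?P o\<^sub>L (T + adj T) o\<^sub>L ?P)) x) x \<in> \<real>\<^sub>\<ge>\<^sub>0"
      using bound[of x] by (simp only: nonneg_Reals_of_real_iff)
  qed
qed

lemma upper_norm_paving_imp_upper_sym_paving:
  assumes "upper_norm_paving"
  shows "upper_sym_paving"
  unfolding upper_sym_paving_def
proof (intro ballI allI impI)
  fix T and \<epsilon> :: real
  assume T: "T \<in> strictly_upper_ops" and "\<epsilon> > 0"
  then have "\<epsilon> / 2 > 0" by simp
  then obtain r A where A: "paving r A"
    "\<forall>i\<in>{1..r}. norm (diag_proj (A i) o\<^sub>L T o\<^sub>L diag_proj (A i)) < \<epsilon> / 2"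
    using assms T unfolding upper_norm_paving_def by blast
  moreover have "T \<in> bounded_ops"
    using T by (simp add: strictly_upper_ops_def)
  ultimately show "\<exists>r A. paving r A \<and> (\<forall>i\<in>{1..r}.
      - (\<epsilon> *\<^sub>R diag_proj (A i)) \<preceq> diag_proj (A i) o\<^sub>L (T + adj T) o\<^sub>L diag_proj (A i) \<and>
      diag_proj (A i) o\<^sub>L (T + adj T) o\<^sub>L diag_proj (A i) \<preceq> \<epsilon> *\<^sub>R diag_proj (A i))"
    by (intro exI[of _ r] exI[of _ A]) (auto intro!: compression_order_bound intro: less_imp_le)
qed

section \<open>Values of extensions on triangular operators under the paving condition\<close>

lemma state_extension_strictly_upper_Re:
  assumes paving: "upper_sym_paving" and ext: "state_extension \<omega> \<phi>" and T: "T \<in> strictly_upper_ops"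
  shows "Re (\<phi> T) = 0"
proof -
  have \<phi>: "state \<phi>" and bo: "T \<in> bounded_ops"
    using ext T by (simp_all add: state_extension_def strictly_upper_ops_def)
  let ?S = "T + adj T"
  have S: "?S \<in> bounded_ops"
    using bo by (intro bounded_ops_closed)
  have "\<bar>Re (\<phi> ?S)\<bar> \<le> \<epsilon>" if \<epsilon>: "\<epsilon> > 0" for \<epsilon> :: real
  proof -
    obtain r A where A: "paving r A" and le: "\<And>i. i \<in> {1..r} \<Longrightarrow>
        - (\<epsilon> *\<^sub>R diag_proj (A i)) \<preceq> diag_proj (A i) o\<^sub>L ?S o\<^sub>L diag_proj (A i) \<and>
        diag_proj (A i) o\<^sub>L ?S o\<^sub>L diag_proj (A i) \<preceq> \<epsilon> *\<^sub>R diag_proj (A i)"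
      using paving T \<epsilon> unfolding upper_sym_paving_def by metis
    \<comment> \<open>An ultrafilter contains one piece of any finite partition. On that piece the
      projection has state value 1, so compressing to it does not change the value of the
      state.\<close>
    have "\<forall>n. \<exists>i\<in>{1..r}. n \<in> A i"
      using A unfolding paving_def by blast
    then obtain i where i: "i \<in> {1..r}" "\<forall>\<^sub>F n in ultrafilter \<omega>. n \<in> A i"
      using ultrafilter_finite_Union[OF ultra_ultrafilter, of "{1..r}" "\<lambda>i n. n \<in> A i" \<omega>]
      by (auto simp: always_eventually)
    let ?P = "diag_proj (A i)"
    have P: "?P \<in> bounded_ops" "\<epsilon> *\<^sub>R ?P \<in> bounded_ops" "- (\<epsilon> *\<^sub>R ?P) = (- \<epsilon>) *\<^sub>R ?P"
      by (simp_all add: bounded_ops_closed bounded_ops_scaleR)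
    have 1: "\<phi> ?P = 1"
      by (rule state_extension_diag_proj[OF ext i(2)])
    have "Re (\<phi> (?P o\<^sub>L ?S o\<^sub>L ?P)) \<le> Re (\<phi> (\<epsilon> *\<^sub>R ?P))"
      by (intro state_mono[OF \<phi>] bounded_ops_closed S P conjunct2[OF le[OF i(1)]])
    moreover have "Re (\<phi> (- (\<epsilon> *\<^sub>R ?P))) \<le> Re (\<phi> (?P o\<^sub>L ?S o\<^sub>L ?P))"
      by (intro state_mono[OF \<phi>] bounded_ops_closed S P(1,2) conjunct1[OF le[OF i(1)]])
    ultimately show ?thesis
      unfolding P(3) state_scaleR[OF \<phi> P(1)] 1 state_compression[OF \<phi> S 1] by simp
  qed
  then have "\<bar>Re (\<phi> ?S)\<bar> \<le> 0"
    by (rule field_le_epsilon) simp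
  then show ?thesis
    using bo by (simp add: state_add[OF \<phi>] bounded_ops_closed state_adj[OF \<phi>])
qed

text \<open>Multiplication by \<open>- \<i>\<close> preserves strict triangularity and turns the
  imaginary part of the value into the real part.\<close>

lemma state_extension_strictly_upper:
  assumes "upper_sym_paving" and ext: "state_extension \<omega> \<phi>" and T: "T \<in> strictly_upper_ops"
  shows "\<phi> T = 0"
proof -
  have "scaleC_op (- \<i>) T \<in> strictly_upper_ops"
    using T by (simp add: strictly_upper_ops_def bounded_ops_closed entry_simps)
  then have "Re (\<phi> (scaleC_op (- \<i>) T)) = 0"
    using assms by (intro state_extension_strictly_upper_Re)
  moreover have "\<phi> (scaleC_op (- \<i>) T) = - \<i> * \<phi> T"
    using ext T by (simp add: state_scaleC state_extension_def strictly_upper_ops_def)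
  ultimately show ?thesis
    using state_extension_strictly_upper_Re[OF assms] by (simp add: complex_eq_iff)
qed

definition upper_ops :: "(ell2 \<Rightarrow>\<^sub>L ell2) set"
  where "upper_ops = {X \<in> bounded_ops. \<forall>i j. i > j \<longrightarrow> entry X i j = 0}"

text \<open>The diagonal of a bounded operator is itself bounded, so it can be subtracted, leaving a
  strictly upper triangular operator on which the extension vanishes.\<close>

lemma state_extension_upper:
  assumes paving: "upper_sym_paving" and ext: "state_extension \<omega> \<phi>" and X: "X \<in> upper_ops"
  shows "\<phi> X = eval_state \<omega> X"
proof -
  define D where "D = diag_op (\<lambda>n. entry X n n)"
  have D: "D \<in> diagonal_ops" and eD: "entry D i j = (if i = j then entry X i i else 0)" for i j
    by (simp_all add: D_def diag_op_diagonal_ops entry_diag_op bounded_diagonal_entries)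
  have bo: "X \<in> bounded_ops" "D \<in> bounded_ops"
    using X D by (simp_all add: upper_ops_def diagonal_ops_def)
  have "X - D \<in> strictly_upper_ops"
    using X bo by (auto simp: strictly_upper_ops_def upper_ops_def bounded_ops_closed entry_simps eD)
  then have "\<phi> (X - D) = 0"
    by (rule state_extension_strictly_upper[OF paving ext])
  then have "\<phi> X = \<phi> D"
    using ext bo by (simp add: state_extension_def state_diff)
  also have "\<dots> = eval_state \<omega> X"
    using ext D by (simp add: state_extension_def) (simp add: eval_state_def eD)
  finally show ?thesis .
qed


section \<open>Cholesky factorization\<close>

text \<open>The analysis operator of a Bessel sequence: the Bessel inequality makes the coefficients
  square summable and bounds the map by \<open>sqrt b\<close>. It is used for a family orthonormal
  with respect to the form of \<open>P\<close>.\<close>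

lemma analysis_operator:
  fixes f :: "nat \<Rightarrow> ell2"
  assumes "b \<ge> 0" and bessel: "\<And>y N. (\<Sum>n<N. (cmod (cinner y (f n)))\<^sup>2) \<le> b * (norm y)\<^sup>2"
  obtains W where "W \<in> bounded_ops" and "\<And>y n. coord (blinfun_apply W y) n = cinner y (f n)"
proof -
  define g where "g y = Abs_ell2 (\<lambda>n. cinner y (f n))" for y
  have summ: "summable (\<lambda>n. (cmod (cinner y (f n)))\<^sup>2)" for y
    by (rule bounded_imp_summable[where B = "b * (norm y)\<^sup>2"])
      (use bessel[of y "Suc _"] in \<open>auto simp: lessThan_Suc_atMost\<close>)
  have coord_g: "coord (g y) n = cinner y (f n)" for y n
    unfolding g_def by (subst Abs_ell2_inverse) (auto simp: summ)
  have bl: "bounded_linear g"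
  proof
    show "g (x + y) = g x + g y" for x y
      by (rule ell2_eqI) (simp add: coord_g plus_ell2.rep_eq cinner_add_left)
    show "g (r *\<^sub>R x) = r *\<^sub>R g x" for r x
      by (rule ell2_eqI)
        (simp only: coord_g scaleR_eq_scaleC scaleC.rep_eq cinner_scaleC_left)
    have "norm (g y) \<le> norm y * sqrt b" for y
    proof (rule power2_le_imp_le)
      have "(norm (g y))\<^sup>2 \<le> b * (norm y)\<^sup>2"
        unfolding norm_ell2_square[of "g y"] coord_g by (rule suminf_le_const[OF summ bessel])
      then show "(norm (g y))\<^sup>2 \<le> (norm y * sqrt b)\<^sup>2"
        using \<open>b \<ge> 0\<close> by (simp add: power_mult_distrib mult.commute)
    qed (use \<open>b \<ge> 0\<close> in simp)
    then show "\<exists>K. \<forall>y. norm (g y) \<le> norm y * K" by blast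
  qed
  have "Blinfun g \<in> bounded_ops"
    unfolding bounded_ops_def mem_Collect_eq bounded_linear_Blinfun_apply[OF bl]
    by (intro allI ell2_eqI) (simp only: coord_g scaleC.rep_eq cinner_scaleC_left)
  then show ?thesis
    by (rule that) (simp add: bounded_linear_Blinfun_apply[OF bl] coord_g)
qed

section \<open>Gram-Schmidt for the inner product given by a coercive operator\<close>

locale positive_definite =
  fixes P :: "ell2 \<Rightarrow>\<^sub>L ell2" and \<delta> :: real
  assumes bo: "P \<in> bounded_ops" and self_adjoint: "adj P = P" and \<delta>: "\<delta> > 0"
    and lower: "\<And>x. \<delta> * (norm x)\<^sup>2 \<le> Re (cinner (P x) x)"
begin

lemma form_commute: "cinner (P y) x = cnj (cinner (P x) y)"
  using self_adjointI[OF bo self_adjoint, of y x] cinner_commute[of y "P x"] by simp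

lemma form_diag: "cinner (P x) x = of_real (Re (cinner (P x) x))"
  using form_commute[of x x] by (simp add: complex_eq_iff)

lemma form_pos: "x \<noteq> 0 \<Longrightarrow> Re (cinner (P x) x) > 0"
  using lower[of x] \<delta> by (smt (verit) mult_pos_pos zero_less_norm_iff zero_less_power)

text \<open>Gram-Schmidt without normalisation for \<open>cinner (P x) y\<close>, applied to the
  standard basis.\<close>

fun gs :: "nat \<Rightarrow> ell2" where
  "gs n = unit_vec n -
    (\<Sum>i<n. scaleC (cinner (P (unit_vec n)) (gs i) / cinner (P (gs i)) (gs i)) (gs i))"

declare gs.simps [simp del]

text \<open>Each step subtracts only vectors supported strictly below \<open>n\<close>. This yields
  both that \<open>gs n\<close> is nonzero and that the factor \<open>V\<close> is
  triangular.\<close>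

lemma coord_gs: "k \<ge> n \<Longrightarrow> coord (gs n) k = (if k = n then 1 else 0)"
proof (induction n rule: less_induct)
  case (less n)
  have "coord (gs n) k = coord (unit_vec n) k -
      (\<Sum>i<n. cinner (P (unit_vec n)) (gs i) / cinner (P (gs i)) (gs i) * coord (gs i) k)"
    by (subst gs.simps) (simp add: minus_ell2.rep_eq coord_sum scaleC.rep_eq)
  also have "(\<Sum>i<n. cinner (P (unit_vec n)) (gs i) / cinner (P (gs i)) (gs i) * coord (gs i) k) = 0"
    using less by (intro sum.neutral) auto
  finally show ?case by (simp add: unit_vec.rep_eq)
qed

lemma gs_nonzero: "gs n \<noteq> 0"
  using coord_gs[of n n] by (auto simp: zero_ell2.rep_eq)

lemma gs_norm_pos: "Re (cinner (P (gs n)) (gs n)) > 0"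
  by (intro form_pos gs_nonzero)

lemma gs_form_nonzero: "cinner (P (gs n)) (gs n) \<noteq> 0"
  using gs_norm_pos[of n] by auto

lemma gs_orthogonal: "m \<noteq> n \<Longrightarrow> cinner (P (gs m)) (gs n) = 0"
proof -
  have below: "\<forall>m<n. cinner (P (gs n)) (gs m) = 0" for n
  proof (induction n rule: less_induct)
    case (less n)
    show ?case
    proof (intro allI impI)
      fix m assume m: "m < n"
      \<comment> \<open>The induction hypothesis gives orthogonality to smaller indices only; it is
        used at \<open>i\<close> or at \<open>m\<close>, whichever is larger, with Hermitian
        symmetry for the other order.\<close>
      have orth: "cinner (P (gs i)) (gs m) = 0" if "i < n" "i \<noteq> m" for i
        using less[of i] less[of m] that m form_commute[of "gs i" "gs m"]
        by (cases i m rule: linorder_cases) auto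
      let ?c = "\<lambda>i. cinner (P (unit_vec n)) (gs i) / cinner (P (gs i)) (gs i)"
      have "cinner (P (gs n)) (gs m)
          = cinner (P (unit_vec n)) (gs m) - (\<Sum>i<n. ?c i * cinner (P (gs i)) (gs m))"
        by (subst gs.simps) (simp add: blinfun.bilinear_simps blinfun.sum_right cinner_linear
            cinner_sum_left bounded_ops_scaleC[OF bo])
      \<comment> \<open>Only the term with index \<open>m\<close> survives, and its coefficient was
        chosen to cancel the first summand.\<close>
      also have "(\<Sum>i<n. ?c i * cinner (P (gs i)) (gs m)) = (\<Sum>i\<in>{m}. ?c i * cinner (P (gs i)) (gs m))"
        using m orth by (intro sum.mono_neutral_right) auto
      finally show "cinner (P (gs n)) (gs m) = 0"
        using gs_form_nonzero[of m] by simp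
    qed
  qed
  show "m \<noteq> n \<Longrightarrow> cinner (P (gs m)) (gs n) = 0"
    using below[of m] below[of n] form_commute[of "gs m" "gs n"]
    by (cases m n rule: linorder_cases) auto
qed

definition onb :: "nat \<Rightarrow> ell2"
  where "onb n = scaleC (1 / of_real (sqrt (Re (cinner (P (gs n)) (gs n))))) (gs n)"

lemma sqrt_form_square:
  "complex_of_real (sqrt (Re (cinner (P (gs n)) (gs n)))) * of_real (sqrt (Re (cinner (P (gs n)) (gs n))))
    = cinner (P (gs n)) (gs n)"
  using gs_norm_pos[of n] form_diag[of "gs n"] by (simp flip: of_real_mult)

lemma onb_orthonormal: "cinner (P (onb m)) (onb n) = (if m = n then 1 else 0)"
  using gs_orthogonal[of m n] gs_form_nonzero[of n] sqrt_form_square[of n]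
  by (simp add: onb_def bounded_ops_scaleC[OF bo] cinner_linear)

lemma coord_onb: "k > n \<Longrightarrow> coord (onb n) k = 0"
  using coord_gs[of n k] by (simp add: onb_def scaleC.rep_eq)

text \<open>The recursion for \<open>gs\<close> solved for the basis vector. The sum stops at
  \<open>n\<close>, which is the triangularity of \<open>U\<close>; the two normalising factors
  combine into the Gram-Schmidt denominator.\<close>

lemma onb_expansion: "unit_vec n = (\<Sum>i\<le>n. scaleC (cinner (P (unit_vec n)) (onb i)) (onb i))"
proof -
  let ?c = "\<lambda>i. cinner (P (unit_vec n)) (gs i) / cinner (P (gs i)) (gs i)"
  have term_eq: "scaleC (cinner (P (unit_vec n)) (onb i)) (onb i) = scaleC (?c i) (gs i)" for i
  proof -
    define s where "s = complex_of_real (sqrt (Re (cinner (P (gs i)) (gs i))))"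
    have s: "?c i = cinner (P (unit_vec n)) (gs i) / (s * s)" "cnj s = s"
      by (simp_all add: s_def sqrt_form_square)
    show ?thesis
      unfolding s(1) onb_def s_def[symmetric] by (simp add: cinner_linear scaleC_scaleC s(2))
  qed
  have unit: "unit_vec n = gs n + (\<Sum>i<n. scaleC (?c i) (gs i))"
    by (subst gs.simps) simp
  \<comment> \<open>\<open>gs n\<close> is orthogonal to its predecessors for the form, so its own
    coefficient is 1 and the bare \<open>gs n\<close> becomes the last term of the sum.\<close>
  have "cinner (P (unit_vec n)) (gs n)
      = cinner (P (gs n)) (gs n) + (\<Sum>i<n. ?c i * cinner (P (gs i)) (gs n))"
    by (subst unit) (simp add: blinfun.bilinear_simps blinfun.sum_right cinner_linear
        cinner_sum_left bounded_ops_scaleC[OF bo])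
  also have "(\<Sum>i<n. ?c i * cinner (P (gs i)) (gs n)) = 0"
    by (intro sum.neutral) (simp add: gs_orthogonal)
  finally have "?c n = 1"
    using gs_form_nonzero[of n] by simp
  then show ?thesis
    using unit unfolding term_eq by (simp add: lessThan_Suc_atMost[symmetric] add.commute)
qed

lemma onb_upper: "n < i \<Longrightarrow> cinner (P (unit_vec n)) (onb i) = 0"
  by (subst onb_expansion) (simp add: blinfun.sum_right cinner_sum_left bounded_ops_scaleC[OF bo]
      cinner_linear onb_orthonormal)

text \<open>For \<open>x\<close> the partial sum with coefficients \<open>cinner y (onb n)\<close>,
  both \<open>cinner y x\<close> and \<open>cinner (P x) x\<close> equal \<open>S\<close>.
  Cauchy-Schwarz and coercivity then bound the square of \<open>S\<close> by a multiple of
  \<open>S\<close>.\<close>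

lemma onb_bessel: "(\<Sum>n<N. (cmod (cinner y (onb n)))\<^sup>2) \<le> 1 / \<delta> * (norm y)\<^sup>2"
proof -
  define S where "S = (\<Sum>n<N. (cmod (cinner y (onb n)))\<^sup>2)"
  define x where "x = (\<Sum>n<N. scaleC (cinner y (onb n)) (onb n))"
  have S0: "S \<ge> 0" unfolding S_def by (intro sum_nonneg) simp
  have "cinner y x = of_real S"
    by (simp add: x_def S_def cinner_sum_right cinner_linear complex_norm_square mult.commute
        del: of_real_power)
  then have "S \<le> norm y * norm x"
    using cinner_cauchy_schwarz[of y x] S0 by simp
  then have S2: "S\<^sup>2 \<le> (norm y)\<^sup>2 * (norm x)\<^sup>2"
    using power_mono[OF _ S0, of "norm y * norm x" 2] by (simp add: power_mult_distrib)
  have "cinner (P x) x = of_real S"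
    by (simp add: x_def S_def blinfun.sum_right cinner_sum_left cinner_sum_right cinner_linear
        bounded_ops_scaleC[OF bo] onb_orthonormal complex_norm_square mult.commute
        if_distrib sum.delta cong: if_cong del: of_real_power)
  then have "(norm x)\<^sup>2 \<le> S / \<delta>"
    using lower[of x] \<delta> by (simp add: field_simps)
  then have "S * S \<le> (1 / \<delta> * (norm y)\<^sup>2) * S"
    using order_trans[OF S2 mult_left_mono[of "(norm x)\<^sup>2" "S / \<delta>" "(norm y)\<^sup>2"]]
    by (simp add: power2_eq_square)
  then show ?thesis
    using S0 \<delta> mult_right_le_imp_le[of S S "1 / \<delta> * (norm y)\<^sup>2"]
    unfolding S_def[symmetric] by (cases "S = 0") auto
qed

text \<open>\<open>W\<close> takes coefficients against \<open>onb\<close>, its adjoint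
  \<open>V\<close> sends the standard basis to \<open>onb\<close>, and \<open>U\<close> is
  \<open>W\<close> after \<open>P\<close>. The expansion of basis vectors says that
  \<open>V o\<^sub>L U\<close> is the identity; with \<open>adj U = P o\<^sub>L V\<close> this gives
  the factorization, and its adjoint gives the inverse of \<open>P\<close>.\<close>

lemma cholesky:
  obtains U V where "U \<in> upper_ops" and "V \<in> upper_ops" and "adj U o\<^sub>L U = P"
    and "P o\<^sub>L (V o\<^sub>L adj V) = id_blinfun" and "\<And>n. entry U n n * entry V n n = 1"
proof -
  obtain W where W: "W \<in> bounded_ops" and coord_W: "\<And>y n. coord (blinfun_apply W y) n = cinner y (onb n)"
    using analysis_operator[of "1 / \<delta>" onb, OF _ onb_bessel] \<delta> by auto
  define V where "V = adj W"
  define U where "U = W o\<^sub>L P"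
  have V: "V \<in> bounded_ops" and U: "U \<in> bounded_ops"
    by (simp_all add: V_def U_def bounded_ops_closed W bo)
  have V_unit: "V (unit_vec n) = onb n" for n
  proof (rule ell2_eqI)
    fix k
    have "coord (V (unit_vec n)) k = cinner (unit_vec n) (W (unit_vec k))"
      unfolding V_def by (simp only: cinner_unit_vec_right[symmetric] cinner_adj_left[OF W])
    also have "\<dots> = cnj (coord (W (unit_vec k)) n)"
      by (simp only: cinner_commute[of "unit_vec n"] cinner_unit_vec_right)
    also have "\<dots> = coord (onb n) k"
      by (simp only: coord_W cinner_commute[symmetric] cinner_unit_vec_right)
    finally show "coord (V (unit_vec n)) k = coord (onb n) k" .
  qed
  have eU: "entry U i j = cinner (P (unit_vec j)) (onb i)" for i j
    by (simp add: U_def entry_eq_coord coord_W)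
  have eV: "entry V i j = coord (onb j) i" for i j
    by (simp add: entry_eq_coord V_unit)
  \<comment> \<open>Triangularity makes the column of \<open>U\<close> a finite sum, so
    \<open>V\<close> can be applied term by term.\<close>
  have U_unit: "U (unit_vec j) = (\<Sum>i\<le>j. scaleC (entry U i j) (unit_vec i))" for j
    by (rule ell2_eqI)
      (auto simp: coord_sum scaleC.rep_eq unit_vec.rep_eq entry_eq_coord[symmetric] if_distrib
        eU onb_upper cong: if_cong)
  have VU: "V o\<^sub>L U = id_blinfun"
  proof (rule bounded_ops_eqI)
    fix n
    have "(V o\<^sub>L U) (unit_vec n) = (\<Sum>i\<le>n. scaleC (cinner (P (unit_vec n)) (onb i)) (onb i))"
      by (simp add: U_unit blinfun.sum_right bounded_ops_scaleC[OF V] V_unit eU)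
    then show "(V o\<^sub>L U) (unit_vec n) = id_blinfun (unit_vec n)"
      by (simp flip: onb_expansion)
  qed (simp_all add: bounded_ops_closed U V)
  have VWP: "V (W (P x)) = x" for x
    using arg_cong[OF VU, of "\<lambda>X. blinfun_apply X x"] by (simp add: U_def)
  show ?thesis
  proof (rule that)
    show "U \<in> upper_ops" "V \<in> upper_ops"
      using U V by (auto simp: upper_ops_def eU eV onb_upper coord_onb)
    have adjU: "adj U = P o\<^sub>L V"
      by (simp add: U_def V_def adj_simps W bo self_adjoint)
    show "adj U o\<^sub>L U = P"
      unfolding adjU by (rule blinfun_eqI) (simp add: U_def VWP)
    have "adj (V o\<^sub>L U) = adj U o\<^sub>L adj V"
      by (rule adj_simps[OF V U])
    moreover have "(P o\<^sub>L V) o\<^sub>L adj V = P o\<^sub>L (V o\<^sub>L adj V)"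
      by (rule blinfun_eqI) simp
    ultimately show "P o\<^sub>L (V o\<^sub>L adj V) = id_blinfun"
      by (simp add: VU adjU)
    fix n
    \<comment> \<open>The \<open>n\<close>-th coordinate of the expansion: \<open>onb i\<close> with
      \<open>i < n\<close> vanishes there, leaving the product of the diagonal entries.\<close>
    have "coord (unit_vec n) n = (\<Sum>i\<le>n. cinner (P (unit_vec n)) (onb i) * coord (onb i) n)"
      by (subst onb_expansion) (simp add: coord_sum scaleC.rep_eq)
    also have "\<dots> = (\<Sum>i\<in>{n}. cinner (P (unit_vec n)) (onb i) * coord (onb i) n)"
      by (intro sum.mono_neutral_right) (auto simp: coord_onb)
    finally show "entry U n n * entry V n n = 1"
      by (simp add: eU eV unit_vec.rep_eq)
  qed
qed

text \<open>Coercivity at \<open>Q x\<close>, where \<open>P (Q x) = x\<close>, and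
  Cauchy-Schwarz.\<close>

lemma norm_right_inverse_le:
  assumes "P o\<^sub>L Q = id_blinfun"
  shows "norm Q \<le> 1 / \<delta>"
proof (rule norm_blinfun_bound)
  show "0 \<le> 1 / \<delta>" using \<delta> by simp
  fix x
  have "P (Q x) = x"
    using arg_cong[OF assms, of "\<lambda>X. blinfun_apply X x"] by simp
  then have "\<delta> * (norm (Q x))\<^sup>2 \<le> norm x * norm (Q x)"
    using lower[of "Q x"] complex_Re_le_cmod[of "cinner x (Q x)"] cinner_cauchy_schwarz[of x "Q x"]
    by simp
  then show "norm (Q x) \<le> 1 / \<delta> * norm x"
    using \<delta> by (cases "Q x = 0") (auto simp: power2_eq_square field_simps)
qed

end


section \<open>Uniqueness of extensions\<close>

text \<open>The diagonals of the two Cholesky factors are mutually inverse, and the states agree on them.\<close>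

lemma state_extension_product_ge_1:
  assumes paving: "upper_sym_paving" and \<phi>: "state_extension \<omega> \<phi>" and \<psi>: "state_extension \<omega> \<psi>"
    and P: "positive_definite P \<delta>"
  obtains Q where "Q \<in> bounded_ops" and "P o\<^sub>L Q = id_blinfun" and "1 \<le> Re (\<phi> P) * Re (\<psi> Q)"
proof -
  have st: "state \<phi>" "state \<psi>"
    using \<phi> \<psi> by (simp_all add: state_extension_def)
  obtain U V where UV: "U \<in> upper_ops" "V \<in> upper_ops" "adj U o\<^sub>L U = P"
      "P o\<^sub>L (V o\<^sub>L adj V) = id_blinfun" "\<And>n. entry U n n * entry V n n = 1"
    using positive_definite.cholesky[OF P] by metis
  have bo: "U \<in> bounded_ops" "V \<in> bounded_ops"
    using UV by (simp_all add: upper_ops_def)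
  have "((\<lambda>n. entry U n n * entry V n n) \<longlongrightarrow> eval_state \<omega> U * eval_state \<omega> V) (ultrafilter \<omega>)"
    by (intro tendsto_mult eval_state_tendsto)
  then have "\<phi> U * \<psi> V = 1"
    using tendsto_unique[OF ultrafilter_not_bot _ tendsto_const]
    by (simp add: UV(5) state_extension_upper[OF paving \<phi> UV(1)] state_extension_upper[OF paving \<psi> UV(2)])
  then have "cmod (\<phi> U) * cmod (\<psi> V) = 1"
    by (simp flip: norm_mult)
  then have "1 = (cmod (\<phi> U))\<^sup>2 * (cmod (\<psi> V))\<^sup>2"
    by (simp flip: power_mult_distrib)
  also have "\<dots> \<le> Re (\<phi> P) * Re (\<psi> (V o\<^sub>L adj V))"
  proof (rule mult_mono)
    show U: "(cmod (\<phi> U))\<^sup>2 \<le> Re (\<phi> P)"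
      using state_kadison[OF st(1) bo(1)] by (simp add: UV(3))
    \<comment> \<open>Kadison's inequality is applied to \<open>adj V\<close>, so that the product
      appears in the order required for the inverse of \<open>P\<close>.\<close>
    show "(cmod (\<psi> V))\<^sup>2 \<le> Re (\<psi> (V o\<^sub>L adj V))"
      using state_kadison[OF st(2) bounded_ops_closed(7)[OF bo(2)]]
      by (simp add: state_adj[OF st(2)] bo adj_adj)
    show "0 \<le> Re (\<phi> P)"
      by (rule order_trans[OF zero_le_power2 U])
  qed simp
  finally show ?thesis
    by (intro that[of "V o\<^sub>L adj V"] UV(4) bounded_ops_closed bo)
qed

text \<open>Expanding the product leaves \<open>t * (a - b)\<close> plus a term of order
  \<open>t\<^sup>2\<close>, which must be nonnegative for small \<open>t\<close> of either
  sign.\<close>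

lemma first_order_comparison:
  fixes a b h :: real
  assumes a: "\<bar>a\<bar> \<le> h" and b: "\<bar>b\<bar> \<le> h"
    and ge: "\<And>t. \<bar>t\<bar> * h \<le> 1 / 2 \<Longrightarrow>
      \<exists>c. \<bar>c\<bar> \<le> 2 * h\<^sup>2 \<and> 1 \<le> (1 + t * a) * (1 - t * b + t\<^sup>2 * c)"
  shows "a = b"
proof (rule ccontr)
  assume "a \<noteq> b"
  define d where "d = a - b"
  have h: "h > 0" and d: "d \<noteq> 0" "\<bar>d\<bar> \<le> 2 * h"
    using a b \<open>a \<noteq> b\<close> by (auto simp: d_def)
  \<comment> \<open>The sign makes the linear term negative, namely
    \<open>- d\<^sup>2 / (8 * h\<^sup>2)\<close>. The quadratic coefficient is at most
    \<open>5 * h\<^sup>2\<close>, so the rest contributes at most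
    \<open>5 * d\<^sup>2 / (64 * h\<^sup>2)\<close> and cannot compensate.\<close>
  define t where "t = - d / (8 * h\<^sup>2)"
  have th: "\<bar>t\<bar> * h \<le> 1 / 2"
    using h d(2) by (simp add: t_def abs_mult power2_eq_square field_simps)
  then obtain c where c: "\<bar>c\<bar> \<le> 2 * h\<^sup>2" "1 \<le> (1 + t * a) * (1 - t * b + t\<^sup>2 * c)"
    using ge by blast
  have ta: "\<bar>t * a\<bar> \<le> 1"
    using mult_left_mono[OF a, of "\<bar>t\<bar>"] th by (simp add: abs_mult)
  have "\<bar>(1 + t * a) * c\<bar> \<le> 2 * (2 * h\<^sup>2)"
    unfolding abs_mult using ta c(1) by (intro mult_mono) auto
  moreover have "\<bar>a * b\<bar> \<le> h\<^sup>2"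
    unfolding abs_mult power2_eq_square using a b by (intro mult_mono) auto
  ultimately have "\<bar>(1 + t * a) * c - a * b\<bar> \<le> 5 * h\<^sup>2"
    by linarith
  then have "t\<^sup>2 * ((1 + t * a) * c - a * b) \<le> t\<^sup>2 * (5 * h\<^sup>2)"
    by (intro mult_left_mono) auto
  moreover have "0 \<le> t * d + t\<^sup>2 * ((1 + t * a) * c - a * b)"
    using c(2) by (simp add: d_def algebra_simps power2_eq_square)
  ultimately have "0 \<le> t * d + t\<^sup>2 * (5 * h\<^sup>2)"
    by linarith
  also have "\<dots> = - 3 * d\<^sup>2 / (64 * h\<^sup>2)"
    using h by (simp add: t_def field_simps power2_eq_square)
  finally show False
    using h d(1) by (simp add: field_simps)
qed

text \<open>Apply the previous inequality to \<open>1 + t H\<close>, whose inverse is \<open>1 - t H + O(t\<^sup>2)\<close>.\<close>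

lemma state_extension_unique_self_adjoint:
  assumes paving: "upper_sym_paving" and \<phi>: "state_extension \<omega> \<phi>" and \<psi>: "state_extension \<omega> \<psi>"
    and H: "H \<in> bounded_ops" and adjH: "adj H = H"
  shows "Re (\<phi> H) = Re (\<psi> H)"
proof (rule first_order_comparison[where h = "norm H"])
  have st: "state \<phi>" "state \<psi>"
    using \<phi> \<psi> by (simp_all add: state_extension_def)
  show "\<bar>Re (\<phi> H)\<bar> \<le> norm H" "\<bar>Re (\<psi> H)\<bar> \<le> norm H"
    using st H by (auto intro: order_trans[OF abs_Re_le_cmod state_norm_le])
  fix t :: real
  assume t: "\<bar>t\<bar> * norm H \<le> 1 / 2"
  define P where "P = id_blinfun + t *\<^sub>R H"
  have tH: "t *\<^sub>R H \<in> bounded_ops"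
    by (rule bounded_ops_scaleR[OF H])
  have P: "P \<in> bounded_ops"
    unfolding P_def by (intro bounded_ops_closed tH)
  \<comment> \<open>The bound on \<open>t\<close> lets the perturbation remove at most half of the
    squared norm.\<close>
  interpret positive_definite P "1 / 2"
  proof
    show "adj P = P"
      by (simp add: P_def adj_simps bounded_ops_closed tH scaleR_eq_scaleC_op adj_scaleC_op H adjH)
    fix x
    have "\<bar>t * Re (cinner (H x) x)\<bar> \<le> \<bar>t\<bar> * (norm (H x) * norm x)"
      unfolding abs_mult
      by (intro mult_left_mono order_trans[OF abs_Re_le_cmod cinner_cauchy_schwarz]) simp
    also have "\<dots> \<le> \<bar>t\<bar> * ((norm H * norm x) * norm x)"
      by (intro mult_left_mono mult_right_mono norm_blinfun) auto
    also have "\<dots> = (\<bar>t\<bar> * norm H) * (norm x)\<^sup>2"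
      by (simp add: power2_eq_square)
    also have "\<dots> \<le> 1 / 2 * (norm x)\<^sup>2"
      by (intro mult_right_mono t) simp
    finally have "\<bar>t * Re (cinner (H x) x)\<bar> \<le> 1 / 2 * (norm x)\<^sup>2" .
    moreover have "Re (cinner (P x) x) = (norm x)\<^sup>2 + t * Re (cinner (H x) x)"
      by (simp add: P_def plus_blinfun.rep_eq scaleR_blinfun.rep_eq scaleR_eq_scaleC cinner_linear
          cinner_self del: of_real_power)
    ultimately show "1 / 2 * (norm x)\<^sup>2 \<le> Re (cinner (P x) x)"
      by linarith
  qed (use P in auto)
  obtain Q where Q: "Q \<in> bounded_ops" "P o\<^sub>L Q = id_blinfun" "1 \<le> Re (\<phi> P) * Re (\<psi> Q)"
    using state_extension_product_ge_1[OF paving \<phi> \<psi> positive_definite_axioms] by blast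
  \<comment> \<open>The remainder after substituting \<open>Q = 1 - t H Q\<close> into itself once;
    \<open>norm Q \<le> 2\<close> by coercivity with constant 1/2, which gives the bound on
    \<open>R\<close>.\<close>
  define R where "R = H o\<^sub>L (H o\<^sub>L Q)"
  have R: "R \<in> bounded_ops"
    unfolding R_def by (intro bounded_ops_closed H Q(1))
  have Qx: "Q x = x - t *\<^sub>R H (Q x)" for x
    using arg_cong[OF Q(2), of "\<lambda>X. blinfun_apply X x"]
    by (simp add: P_def blinfun.bilinear_simps eq_diff_eq)
  have "Q = id_blinfun - t *\<^sub>R H + (t\<^sup>2) *\<^sub>R R"
  proof (rule blinfun_eqI)
    fix x
    have "Q x = x - t *\<^sub>R H (x - t *\<^sub>R H (Q x))"
      using Qx[of x] by simp
    then show "Q x = (id_blinfun - t *\<^sub>R H + (t\<^sup>2) *\<^sub>R R) x"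
      by (simp add: R_def blinfun.bilinear_simps algebra_simps power2_eq_square)
  qed
  then have "\<psi> Q = 1 - of_real t * \<psi> H + of_real (t\<^sup>2) * \<psi> R"
    using state_add[OF st(2)] state_diff[OF st(2)] state_scaleR[OF st(2)] state_id[OF st(2)]
    by (simp add: bounded_ops_closed H R bounded_ops_scaleR del: of_real_power)
  then have psiQ: "Re (\<psi> Q) = 1 - t * Re (\<psi> H) + t\<^sup>2 * Re (\<psi> R)"
    by (simp del: of_real_power)
  have phiP: "Re (\<phi> P) = 1 + t * Re (\<phi> H)"
    by (simp add: P_def state_add[OF st(1)] state_scaleR[OF st(1)] state_id[OF st(1)]
        bounded_ops_closed H tH)
  have "\<bar>Re (\<psi> R)\<bar> \<le> norm R"
    by (rule order_trans[OF abs_Re_le_cmod state_norm_le[OF st(2) R]])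
  also have "\<dots> \<le> norm H * (norm H * norm Q)"
    unfolding R_def
    by (intro order_trans[OF norm_blinfun_compose] mult_left_mono norm_blinfun_compose norm_ge_zero)
  also have "\<dots> \<le> norm H * (norm H * 2)"
    using norm_right_inverse_le[OF Q(2)] by (intro mult_left_mono) auto
  finally have "\<bar>Re (\<psi> R)\<bar> \<le> 2 * (norm H)\<^sup>2"
    by (simp add: power2_eq_square)
  then show "\<exists>c. \<bar>c\<bar> \<le> 2 * (norm H)\<^sup>2 \<and> 1 \<le> (1 + t * Re (\<phi> H)) * (1 - t * Re (\<psi> H) + t\<^sup>2 * c)"
    using Q(3) unfolding phiP psiQ by blast
qed

text \<open>The self-adjoint \<open>Y + adj Y\<close> captures real parts for arbitrary
  \<open>Y\<close>, and multiplying by \<open>- \<i>\<close> turns imaginary parts into real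
  ones.\<close>

lemma state_extension_unique:
  assumes paving: "upper_sym_paving" and \<phi>: "state_extension \<omega> \<phi>" and \<psi>: "state_extension \<omega> \<psi>"
    and X: "X \<in> bounded_ops"
  shows "\<phi> X = \<psi> X"
proof -
  have st: "state \<phi>" "state \<psi>"
    using \<phi> \<psi> by (simp_all add: state_extension_def)
  have re: "Re (\<phi> Y) = Re (\<psi> Y)" if Y: "Y \<in> bounded_ops" for Y
  proof -
    have "adj (Y + adj Y) = Y + adj Y"
      by (simp add: adj_simps bounded_ops_closed Y adj_adj add.commute)
    then have "Re (\<phi> (Y + adj Y)) = Re (\<psi> (Y + adj Y))"
      by (intro state_extension_unique_self_adjoint[OF paving \<phi> \<psi>] bounded_ops_closed Y)
    then show ?thesis
      by (simp add: state_add st bounded_ops_closed Y state_adj)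
  qed
  have "Re (- \<i> * \<phi> X) = Re (- \<i> * \<psi> X)"
    using re[of "scaleC_op (- \<i>) X"] X state_scaleC[OF st(1) X] state_scaleC[OF st(2) X]
    by (simp add: bounded_ops_closed)
  then show ?thesis
    using re[OF X] by (simp add: complex_eq_iff)
qed

lemma upper_sym_paving_imp_kadison_singer:
  assumes "upper_sym_paving"
  shows "kadison_singer"
  unfolding kadison_singer_def
proof
  fix \<omega>
  obtain \<phi> where "state_extension \<omega> \<phi>"
    using eval_state_extension by blast
  then show "\<exists>\<phi>. state_extension \<omega> \<phi> \<and>
      (\<forall>\<psi>. state_extension \<omega> \<psi> \<longrightarrow> (\<forall>X\<in>bounded_ops. \<psi> X = \<phi> X))"
    using state_extension_unique[OF assms] by blast
qed

theorem corollary2p12: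
  shows "(kadison_singer \<longleftrightarrow> upper_sym_paving) \<and> (upper_sym_paving \<longleftrightarrow> upper_norm_paving)"
  using kadison_singer_imp_upper_norm_paving upper_norm_paving_imp_upper_sym_paving
    upper_sym_paving_imp_kadison_singer by blast

end
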